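(* There exist a sequence $Q^{(N)}$, $N=1,2,\ldots$, of finite, rooted, binary tree-structured partitions of $\mathcal{U}^2=(0,1)^2$ into basic boxes with $\|Q^{(N)}\|\to 0$, and independent, identically distributed random vectors $(\mathbf{X},Y),(\mathbf{X}_1,Y_1),(\mathbf{X}_2,Y_2),\ldots$ on a common probability space, where $\mathbf{X}$ is uniformly distributed on $\mathcal{U}^2$, $Y$ is real-valued and $E(|Y|)<\infty$, such that $$P\big(\hat h_N(\mathbf{X})-h_N(\mathbf{X})\to 0\big)=1,\qquad P\big(h_N(\mathbf{X})-h(\mathbf{X})\to 0\big)=0,$$ and $$P\big(\hat h_N(\mathbf{X})\to h(\mathbf{X})\big)=0 .$$
   Context: Basic boxes. A basic box in $\mathcal{U}^2=(0,1)^2$ is a nonempty subset of $\mathcal{U}^2$ that is the solution set in $\mathcal{U}^2$ of a finite system of inequalities of the form $\mathbf{b}\cdot\mathbf{x}\le c$ or $\mathbf{b}\cdot\mathbf{x}>c$, where in each inequality $c$ is real and exactly one coordinate of $\mathbf{b}\in\mathbb{R}^2$ is nonzero. Thus it is a rectangle with sides parallel to the axes, each side being open or closed. Finite rooted binary tree. This is a finite nonempty set $T$ of positive integers with functions $\mathrm{left},\mathrm{right}:T\to T\cup\{0\}$ such that (1) for each $t\in T$ either $\mathrm{left}(t)=\mathrm{right}(t)=0$ ($t$ is then called terminal), or $\mathrm{left}(t)>t$ and $\mathrm{right}(t)>t$; (2) for each $t\in T$ other than the smallest element (the root) there is exactly one $s\in T$ with $t=\mathrm{left}(s)$ or $t=\mathrm{right}(s)$.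 Tree-structured partition. A finite partition of $\mathcal{U}^2$ into basic boxes is a finite, rooted, binary tree-structured partition if there is a finite rooted binary tree whose terminal nodes correspond bijectively to the members of the partition, compatibly with nesting: each node $t$ is associated with a basic box, the root with $\mathcal{U}^2$, the box of each nonterminal node is the disjoint union of the boxes of its left and right children, and the boxes of the terminal nodes are exactly the members of the partition. For $\mathbf{x}\in\mathcal{U}^2$, $B^{(N)}(\mathbf{x})$ is the unique member of $Q^{(N)}$ containing $\mathbf{x}$. The norm is $\|Q^{(N)}\|=\max_{\mathbf{x}}\sup\{\|\mathbf{z}-\mathbf{y}\|:\mathbf{y},\mathbf{z}\in B^{(N)}(\mathbf{x})\}$ (Euclidean distance). Regression function: $h(\mathbf{x})=E(Y\mid\mathbf{X}=\mathbf{x})$. For $P(\mathbf{X}\in B^{(N)}(\mathbf{x}))>0$ define $$h_N(\mathbf{x})=\frac{E\big(Y\,I_{B^{(N)}(\mathbf{x})}(\mathbf{X})\big)}{P(\mathbf{X}\in B^{(N)}(\mathbf{x}))},$$ where inside the expectation $\mathbf{X}$ is random and $\mathbf{x}$ is fixed; $h_N(\mathbf{X})$ is this function evaluated at $\mathbf{X}$. Empirical estimate: with $B=B^{(N)}(\mathbf{x})$, $\hat\mu_N(B)=\frac1N\sum_{n=1}^N Y_nI_B(\mathbf{X}_n)$ and $\hat F_N(B)=\frac1N\sum_{n=1}^N I_B(\mathbf{X}_n)$, set $\hat h_N(\mathbf{x})=\hat\mu_N(B)/\hat F_N(B)$ if $\hat F_N(B)>0$ and $\hat h_N(\mathbf{x})=0$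 otherwise. *)

theory Defs
  imports "HOL-Probability.Probability" "HOL-Library.Disjoint_Sets"
begin

text \<open>
  The plane is the type \<^typ>\<open>real \<times> real\<close>, whose library inner product, norm and distance are the
  Euclidean ones.
\<close>

definition unit_square :: "(real \<times> real) set" where
  "unit_square = {0<..<1} \<times> {0<..<1}"

definition axis_normal :: "real \<times> real \<Rightarrow> bool" where
  "axis_normal b \<longleftrightarrow> (fst b \<noteq> 0 \<and> snd b = 0) \<or> (fst b = 0 \<and> snd b \<noteq> 0)"

text \<open>In a system of inequalities, \<open>L\<close> holds the pairs \<open>(b, c)\<close> for the non-strict inequalities and
  \<open>G\<close> those for the strict ones; both may be empty.\<close>

definition basic_box :: "(real \<times> real) set \<Rightarrow> bool" where
  "basic_box B \<longleftrightarrow> B \<noteq> {} \<and>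
     (\<exists>L G :: ((real \<times> real) \<times> real) set.
        finite L \<and> finite G \<and> (\<forall>(b, c) \<in> L \<union> G. axis_normal b) \<and>
        B = {x \<in> unit_square. (\<forall>(b, c) \<in> L. b \<bullet> x \<le> c) \<and> (\<forall>(b, c) \<in> G. b \<bullet> x > c)})"

definition rooted_binary_tree :: "nat set \<Rightarrow> (nat \<Rightarrow> nat) \<Rightarrow> (nat \<Rightarrow> nat) \<Rightarrow> bool" where
  "rooted_binary_tree T left right \<longleftrightarrow>
     finite T \<and> T \<noteq> {} \<and> 0 \<notin> T \<and>
     left ` T \<subseteq> T \<union> {0} \<and> right ` T \<subseteq> T \<union> {0} \<and>
     (\<forall>t\<in>T. (left t = 0 \<and> right t = 0) \<or> (left t > t \<and> right t > t)) \<and>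
     (\<forall>t\<in>T - {Min T}. \<exists>!s. s \<in> T \<and> (t = left s \<or> t = right s))"

definition terminal_nodes :: "nat set \<Rightarrow> (nat \<Rightarrow> nat) \<Rightarrow> (nat \<Rightarrow> nat) \<Rightarrow> nat set" where
  "terminal_nodes T left right = {t \<in> T. left t = 0 \<and> right t = 0}"

definition tree_structured_partition :: "(real \<times> real) set set \<Rightarrow> bool" where
  "tree_structured_partition Q \<longleftrightarrow>
     finite Q \<and> partition_on unit_square Q \<and> (\<forall>B\<in>Q. basic_box B) \<and>
     (\<exists>T left right bx.
        rooted_binary_tree T left right \<and>
        (\<forall>t\<in>T. basic_box (bx t)) \<and>
        bx (Min T) = unit_square \<and>
        (\<forall>t\<in>T - terminal_nodes T left right.
           bx t = bx (left t) \<union> bx (right t) \<and> bx (left t) \<inter> bx (right t) = {}) \<and>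
        bij_betw bx (terminal_nodes T left right) Q)"

text \<open>Only meaningful for points of the unit square.\<close>

definition cell :: "(real \<times> real) set set \<Rightarrow> real \<times> real \<Rightarrow> (real \<times> real) set" where
  "cell Q x = (THE B. B \<in> Q \<and> x \<in> B)"

definition partition_norm :: "(real \<times> real) set set \<Rightarrow> real" where
  "partition_norm Q = Max ((\<lambda>x. diameter (cell Q x)) ` unit_square)"

text \<open>\<open>h\<close> is a version of the regression function \<open>E(Y | X = x)\<close>; versions agree almost everywhere
  with respect to the distribution of \<open>X\<close>.\<close>

definition regression_function ::
  "'w measure \<Rightarrow> ('w \<Rightarrow> real \<times> real) \<Rightarrow> ('w \<Rightarrow> real) \<Rightarrow> (real \<times> real \<Rightarrow> real) \<Rightarrow> bool" where
  "regression_function M X Y h \<longleftrightarrow>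
     h \<in> borel_measurable borel \<and>
     (AE \<omega> in M. real_cond_exp M (vimage_algebra (space M) X borel) Y \<omega> = h (X \<omega>))"

text \<open>When the cell of \<open>x\<close> has probability zero, where the quotient is not defined on paper, this is
  \<open>0\<close>; for a finite partition \<open>X\<close> falls into such cells with probability zero.\<close>

definition cell_mean ::
  "'w measure \<Rightarrow> ('w \<Rightarrow> real \<times> real) \<Rightarrow> ('w \<Rightarrow> real) \<Rightarrow> (real \<times> real) set set \<Rightarrow> real \<times> real \<Rightarrow> real" where
  "cell_mean M X Y Q x =
     (\<integral>\<omega>. Y \<omega> * indicator (cell Q x) (X \<omega>) \<partial>M) / measure M {\<omega> \<in> space M. X \<omega> \<in> cell Q x}"

text \<open>In the empirical quantities, \<open>xs\<close> and \<open>ys\<close> are the realised samples; only the entries with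
  index \<open>1, \<dots>, N\<close> are used.\<close>

definition empirical_mu ::
  "nat \<Rightarrow> (nat \<Rightarrow> real \<times> real) \<Rightarrow> (nat \<Rightarrow> real) \<Rightarrow> (real \<times> real) set \<Rightarrow> real" where
  "empirical_mu N xs ys B = (1 / real N) * (\<Sum>n=1..N. ys n * indicator B (xs n))"

definition empirical_F :: "nat \<Rightarrow> (nat \<Rightarrow> real \<times> real) \<Rightarrow> (real \<times> real) set \<Rightarrow> real" where
  "empirical_F N xs B = (1 / real N) * (\<Sum>n=1..N. indicator B (xs n))"

definition empirical_cell_mean ::
  "nat \<Rightarrow> (nat \<Rightarrow> real \<times> real) \<Rightarrow> (nat \<Rightarrow> real) \<Rightarrow> (real \<times> real) set set \<Rightarrow> real \<times> real \<Rightarrow> real" where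
  "empirical_cell_mean N xs ys Q x =
     (if empirical_F N xs (cell Q x) > 0
      then empirical_mu N xs ys (cell Q x) / empirical_F N xs (cell Q x) else 0)"

end

theory Submission
  imports Defs
begin

text \<open>For an integrable function the means over rectangles with sides parallel to the axes
  may diverge almost everywhere, even when the diameters tend to \<open>0\<close>, because the
  side lengths of the rectangles are not comparable. This is used as follows: an integrable
  \<open>h\<close> and dyadic grids with mesh tending to \<open>0\<close> are constructed such
  that the means of \<open>h\<close> over the cells around almost every point are unbounded, and
  the response is taken to be \<open>Y = h(X)\<close>, without noise. Then \<open>h\<close> is the
  regression function and the cell means cannot converge to it. If each grid is kept long enough
  before the next one is used, the law of large numbers makes the empirical cell means follow the
  true ones, so they fail to converge to \<open>h(X)\<close> as well.

  The function \<open>h\<close> rests on one picture. Put mass at a small corner square of side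
  \<open>2^-n\<close> of the unit square. The \<open>n + 1\<close> dyadic rectangles of area
  \<open>2^-n\<close> at that corner all contain the whole mass, but together they form a
  hyperbolic cross of area about \<open>n 2^-n / 2\<close>: the set on which some mean is as large
  as \<open>w\<close> is about \<open>n / 2\<close> times larger than the integral divided by
  \<open>w\<close>. Repeating the picture inside every square of finer and finer grids gives
  independent chances to cover a point, and all the rectangles involved are cells of dyadic grids.
  So the exceptional set can be made small while the integral stays small (lemmas
  \<open>large_mean_at_covered_address\<close> and \<open>large_means_off_small_set\<close>).
  Summing such functions over \<open>m\<close> with integrals and exceptional sets of size
  \<open>2^-m\<close> and means of at least \<open>2^m\<close> gives \<open>h\<close>, by the
  Borel-Cantelli lemma (\<open>divergent_box_means\<close>). Independence is used only through
  counting: the addresses left uncovered after a stage are pairs of an address uncovered before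
  and a block of digits outside the cross.

  The strong law of large numbers for integrable variables is derived from the invariance of a
  product measure under the shift (\<open>strong_law_of_large_numbers\<close>). A law for bounded
  variables would not suffice, since the rectangle means of a bounded function converge almost
  everywhere. The switching times come from a diagonal argument (\<open>slow_diagonal\<close>).\<close>

section \<open>Dyadic grids\<close>

definition dyadic_index :: "nat \<Rightarrow> real \<Rightarrow> nat" where
  "dyadic_index p t = nat \<lfloor>2 ^ p * t\<rfloor>"

text \<open>The horizontal and the vertical resolution are independent of each other: the
  divergence below needs long, thin cells.\<close>

definition dyadic_address :: "nat \<Rightarrow> nat \<Rightarrow> real \<times> real \<Rightarrow> nat \<times> nat" where
  "dyadic_address p q x = (dyadic_index p (fst x), dyadic_index q (snd x))"

definition grid_box :: "nat \<Rightarrow> nat \<Rightarrow> nat \<times> nat \<Rightarrow> (real \<times> real) set" where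
  "grid_box p q ij = {x \<in> unit_square. dyadic_address p q x = ij}"

definition grid :: "nat \<Rightarrow> nat \<Rightarrow> (real \<times> real) set set" where
  "grid p q = (\<lambda>x. grid_box p q (dyadic_address p q x)) ` unit_square"

lemma dyadic_index_eq_iff:
  assumes "0 \<le> t"
  shows "dyadic_index p t = i \<longleftrightarrow> real i / 2 ^ p \<le> t \<and> t < (real i + 1) / 2 ^ p"
proof -
  have "dyadic_index p t = i \<longleftrightarrow> \<lfloor>2 ^ p * t\<rfloor> = int i"
    using assms by (simp add: dyadic_index_def nat_eq_iff)
  also have "\<dots> \<longleftrightarrow> real i \<le> 2 ^ p * t \<and> 2 ^ p * t < real i + 1"
    by (simp add: floor_eq_iff)
  also have "\<dots> \<longleftrightarrow> real i / 2 ^ p \<le> t \<and> t < (real i + 1) / 2 ^ p"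
    by (simp add: field_simps)
  finally show ?thesis .
qed

lemma dyadic_index_less:
  assumes "0 \<le> t" "t < 1"
  shows "dyadic_index p t < 2 ^ p"
proof -
  have "\<lfloor>2 ^ p * t\<rfloor> < (2::int) ^ p"
    using assms by (simp add: floor_less_iff)
  moreover have "0 \<le> \<lfloor>2 ^ p * t\<rfloor>"
    using assms by simp
  ultimately show ?thesis
    unfolding dyadic_index_def by (simp add: nat_less_iff)
qed

text \<open>Dropping the last \<open>n\<close> binary digits of the index; all relations between
  grids of different resolution reduce to this.\<close>

lemma dyadic_index_add_div: "dyadic_index (p + n) t div 2 ^ n = dyadic_index p t"
proof -
  have "\<lfloor>2 ^ p * t\<rfloor> = \<lfloor>2 ^ (p + n) * t / real_of_int (2 ^ n)\<rfloor>"
    by (simp add: power_add field_simps)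
  also have "\<dots> = \<lfloor>2 ^ (p + n) * t\<rfloor> div 2 ^ n"
    by (subst floor_divide_real_eq_div) auto
  finally show ?thesis
    unfolding dyadic_index_def by (simp add: nat_div_distrib' nat_power_eq)
qed

lemma dyadic_index_0: "0 \<le> t \<Longrightarrow> t < 1 \<Longrightarrow> dyadic_index 0 t = 0"
  using dyadic_index_less[of t 0] by simp

lemma dyadic_index_measurable [measurable]: "dyadic_index p \<in> borel \<rightarrow>\<^sub>M count_space UNIV"
  unfolding dyadic_index_def[abs_def] by measurable

lemma dyadic_address_measurable [measurable]:
  "dyadic_address p q \<in> borel \<rightarrow>\<^sub>M count_space UNIV"
proof -
  have "dyadic_address p q \<in> borel \<Otimes>\<^sub>M borel \<rightarrow>\<^sub>M count_space UNIV \<Otimes>\<^sub>M count_space UNIV"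
    unfolding dyadic_address_def[abs_def] by measurable
  then show ?thesis
    by (simp add: borel_prod pair_measure_countable)
qed

lemma unit_square_sets [measurable]: "unit_square \<in> sets borel"
  unfolding unit_square_def by (intro borel_open open_Times) auto

lemma grid_box_sets [measurable]: "grid_box p q ij \<in> sets borel"
  unfolding grid_box_def by measurable

lemma dyadic_address_less:
  "x \<in> unit_square \<Longrightarrow> dyadic_address p q x \<in> {..<2 ^ p} \<times> {..<2 ^ q}"
  by (auto simp: unit_square_def dyadic_address_def intro!: dyadic_index_less)

lemma grid_box_self: "x \<in> unit_square \<Longrightarrow> x \<in> grid_box p q (dyadic_address p q x)"
  by (simp add: grid_box_def)

lemma grid_subset: "grid p q \<subseteq> grid_box p q ` ({..<2 ^ p} \<times> {..<2 ^ q})"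
  using dyadic_address_less by (force simp: grid_def)

lemma finite_grid [simp]: "finite (grid p q)"
  by (rule finite_subset[OF grid_subset]) auto

lemma cell_grid:
  assumes "x \<in> unit_square"
  shows "cell (grid p q) x = grid_box p q (dyadic_address p q x)"
  unfolding cell_def
proof (rule the_equality)
  show "grid_box p q (dyadic_address p q x) \<in> grid p q \<and> x \<in> grid_box p q (dyadic_address p q x)"
    using assms by (auto simp: grid_def grid_box_def)
qed (auto simp: grid_def grid_box_def)

lemma basic_box_grid_box:
  assumes "i < 2 ^ p" "l < 2 ^ q"
  shows "basic_box (grid_box p q (i, l))"
proof -
  define L :: "((real \<times> real) \<times> real) set"
    where "L = {((-1, 0), - (real i / 2 ^ p)), ((0, -1), - (real l / 2 ^ q))}"
  define G :: "((real \<times> real) \<times> real) set"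
    where "G = {((-1, 0), - ((real i + 1) / 2 ^ p)), ((0, -1), - ((real l + 1) / 2 ^ q))}"
  have eq: "grid_box p q (i, l) =
      {x \<in> unit_square. (\<forall>(b, c) \<in> L. b \<bullet> x \<le> c) \<and> (\<forall>(b, c) \<in> G. b \<bullet> x > c)}"
  proof -
    have "dyadic_address p q x = (i, l) \<longleftrightarrow> (\<forall>(b, c) \<in> L. b \<bullet> x \<le> c) \<and> (\<forall>(b, c) \<in> G. b \<bullet> x > c)"
      if "x \<in> unit_square" for x
    proof -
      have "0 \<le> fst x" "0 \<le> snd x"
        using that by (auto simp: unit_square_def)
      then show ?thesis
        unfolding dyadic_address_def L_def G_def
        by (auto simp: dyadic_index_eq_iff inner_prod_def)
    qed
    then show ?thesis
      unfolding grid_box_def by blast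
  qed
  have mid: "(real k + 1/2) / 2 ^ r \<in> {0<..<1} \<and> dyadic_index r ((real k + 1/2) / 2 ^ r) = k"
    if "k < 2 ^ r" for k r :: nat
  proof -
    have "real k + 1 \<le> 2 ^ r"
      using that by (metis Suc_leI of_nat_Suc of_nat_le_iff of_nat_numeral of_nat_power add.commute)
    then show ?thesis
      by (auto simp: dyadic_index_eq_iff divide_simps)
  qed
  have "((real i + 1/2) / 2 ^ p, (real l + 1/2) / 2 ^ q) \<in> grid_box p q (i, l)"
    using mid[OF assms(1)] mid[OF assms(2)]
    by (auto simp: grid_box_def dyadic_address_def unit_square_def)
  then have "grid_box p q (i, l) \<noteq> {}"
    by blast
  moreover have "finite L" "finite G" "\<forall>(b, c) \<in> L \<union> G. axis_normal b"
    by (auto simp: L_def G_def axis_normal_def)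
  ultimately show ?thesis
    unfolding basic_box_def using eq by blast
qed

text \<open>A function \<open>c d\<close> that refines its value by one binary digit at each step
  \<open>d\<close> describes repeated bisection. Its values are the node numbers of a complete
  binary tree in heap order: \<open>c d x\<close> is the node of depth \<open>d\<close> whose box
  contains \<open>x\<close>, and the children of node \<open>t\<close> are \<open>2 * t\<close>
  and \<open>2 * t + 1\<close>. The numbers of the nodes of depth \<open>d\<close> fill the
  interval from \<open>2^d\<close> to \<open>2^(d+1)\<close>, so a number determines its depth.\<close>

lemma tree_structured_partition_heap:
  fixes c :: "nat \<Rightarrow> real \<times> real \<Rightarrow> nat"
  assumes root: "\<And>x. x \<in> unit_square \<Longrightarrow> c 0 x = 1"
    and step: "\<And>x d. x \<in> unit_square \<Longrightarrow> d < D \<Longrightarrow> c (Suc d) x div 2 = c d x"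
    and box: "\<And>d t. d \<le> D \<Longrightarrow> t \<in> {2 ^ d..<2 ^ Suc d} \<Longrightarrow> basic_box {x \<in> unit_square. c d x = t}"
  shows "tree_structured_partition ((\<lambda>x. {y \<in> unit_square. c D y = c D x}) ` unit_square)"
proof -
  define T :: "nat set" where "T = {1..<2 ^ Suc D}"
  define left :: "nat \<Rightarrow> nat" where "left t = (if t < 2 ^ D then 2 * t else 0)" for t
  define right :: "nat \<Rightarrow> nat" where "right t = (if t < 2 ^ D then 2 * t + 1 else 0)" for t
  define bx where "bx t = {x \<in> unit_square. \<exists>d\<le>D. c d x = t}" for t
  let ?Q = "(\<lambda>x. {y \<in> unit_square. c D y = c D x}) ` unit_square"
  have range: "c d x \<in> {2 ^ d..<2 ^ Suc d}" if "x \<in> unit_square" "d \<le> D" for d x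
    using that(2)
  proof (induction d)
    case 0
    then show ?case using root[OF that(1)] by simp
  next
    case (Suc d)
    then have "c (Suc d) x div 2 = c d x" "c d x \<in> {2 ^ d..<2 ^ Suc d}"
      using step[OF that(1)] by auto
    then show ?case by auto
  qed
  have depth_unique: "d = e" if "(t::nat) \<in> {2 ^ d..<2 ^ Suc d}" "t \<in> {2 ^ e..<2 ^ Suc e}" for d e t
  proof -
    have "(2::nat) ^ d < 2 ^ Suc e" "(2::nat) ^ e < 2 ^ Suc d"
      using that by (auto intro: le_less_trans)
    then have "d < Suc e" "e < Suc d"
      by (auto dest: power_less_imp_less_exp[rotated] simp del: power_Suc)
    then show ?thesis
      by simp
  qed
  have bx_eq: "bx t = {x \<in> unit_square. c d x = t}" if "d \<le> D" "t \<in> {2 ^ d..<2 ^ Suc d}" for d t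
    unfolding bx_def using that range depth_unique by blast
  have depth_ex: "\<exists>d\<le>D. t \<in> {2 ^ d..<2 ^ Suc d}" if "t \<in> T" for t
  proof -
    have t: "1 \<le> t" "t < 2 ^ Suc D"
      using that by (auto simp: T_def)
    then obtain d where d: "2 ^ d \<le> t" "t < 2 ^ (d + 1)"
      using ex_power_ivl1[of 2 t] by auto
    have "(2::nat) ^ d < 2 ^ Suc D"
      using d(1) t(2) by (rule le_less_trans)
    then have "d < Suc D"
      by (rule power_less_imp_less_exp[rotated]) simp
    then show ?thesis
      using d by (intro exI[of _ d]) auto
  qed
  have terminal: "terminal_nodes T left right = {2 ^ D..<2 ^ Suc D}"
    unfolding terminal_nodes_def T_def left_def right_def by (auto simp: Suc_le_eq split: if_splits)
  have Min_T: "Min T = 1"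
    unfolding T_def using one_less_power[of "2::nat" "Suc D"] by (intro Min_eqI) (auto simp del: power_Suc)
  have tree: "rooted_binary_tree T left right"
    unfolding rooted_binary_tree_def
  proof (intro conjI)
    show "\<forall>t\<in>T - {Min T}. \<exists>!s. s \<in> T \<and> (t = left s \<or> t = right s)"
    proof
      fix t assume t: "t \<in> T - {Min T}"
      then have "t div 2 \<in> T" "t div 2 < 2 ^ D" "2 \<le> t"
        unfolding Min_T by (auto simp: T_def)
      then have "t div 2 \<in> T \<and> (t = left (t div 2) \<or> t = right (t div 2))"
        unfolding left_def right_def by auto
      moreover have "s = t div 2" if "t = left s \<or> t = right s" for s
        using that \<open>2 \<le> t\<close> unfolding left_def right_def by (auto split: if_splits)
      ultimately show "\<exists>!s. s \<in> T \<and> (t = left s \<or> t = right s)"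
        by blast
    qed
  qed (use one_less_power[of "2::nat" "Suc D"] in \<open>auto simp: T_def left_def right_def\<close>)
  have boxes: "basic_box (bx t)" if "t \<in> T" for t
    using depth_ex[OF that] box bx_eq by auto
  have split: "bx t = bx (left t) \<union> bx (right t) \<and> bx (left t) \<inter> bx (right t) = {}"
    if t: "t \<in> T - terminal_nodes T left right" for t
  proof -
    obtain d where d: "d \<le> D" "t \<in> {2 ^ d..<2 ^ Suc d}"
      using depth_ex t by blast
    have tD: "t < 2 ^ D"
      using t unfolding terminal by (auto simp: T_def)
    have "(2::nat) ^ d \<le> t"
      using d(2) by simp
    from this tD have "(2::nat) ^ d < 2 ^ D"
      by (rule le_less_trans)
    then have "d < D"
      by (rule power_less_imp_less_exp[rotated]) simp
    have "bx (left t) = {x \<in> unit_square. c (Suc d) x = 2 * t}"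
      "bx (right t) = {x \<in> unit_square. c (Suc d) x = 2 * t + 1}"
      using d tD \<open>d < D\<close> by (auto simp: left_def right_def intro!: bx_eq)
    moreover have "bx t = {x \<in> unit_square. c (Suc d) x div 2 = t}"
      using step \<open>d < D\<close> bx_eq[OF d] by auto
    moreover have "m div 2 = t \<longleftrightarrow> m = 2 * t \<or> m = 2 * t + 1" for m
      by auto
    ultimately show ?thesis
      by auto
  qed
  have bij: "bij_betw bx {2 ^ D..<2 ^ Suc D} ?Q"
  proof (rule bij_betw_imageI)
    have ne: "bx t \<noteq> {}" if "t \<in> {2 ^ D..<2 ^ Suc D}" for t
      using boxes[of t] that by (auto simp: basic_box_def T_def)
    show "inj_on bx {2 ^ D..<2 ^ Suc D}"
    proof (rule inj_onI)
      fix s t assume st: "s \<in> {2 ^ D..<2 ^ Suc D}" "t \<in> {2 ^ D..<2 ^ Suc D}" "bx s = bx t"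
      obtain x where "x \<in> bx s" using ne[OF st(1)] by blast
      then have "x \<in> bx s" "x \<in> bx t" using st(3) by auto
      then show "s = t" using bx_eq[of D] st by auto
    qed
    show "bx ` {2 ^ D..<2 ^ Suc D} = ?Q"
    proof (intro equalityI subsetI)
      fix B assume "B \<in> bx ` {2 ^ D..<2 ^ Suc D}"
      then obtain t where t: "t \<in> {2 ^ D..<2 ^ Suc D}" "B = bx t" by blast
      obtain x where "x \<in> bx t" using ne[OF t(1)] by blast
      then show "B \<in> ?Q" using t bx_eq[of D t] by auto
    next
      fix B assume "B \<in> ?Q"
      then obtain x where x: "x \<in> unit_square" "B = {y \<in> unit_square. c D y = c D x}" by blast
      then show "B \<in> bx ` {2 ^ D..<2 ^ Suc D}"
        using bx_eq[of D "c D x"] range[of x D] by auto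
    qed
  qed
  have finite: "finite ?Q"
    using bij_betw_finite[OF bij] by blast
  have basic: "\<forall>B\<in>?Q. basic_box B"
  proof
    fix B assume "B \<in> ?Q"
    with bij obtain t where "t \<in> {2 ^ D..<2 ^ Suc D}" "B = bx t"
      unfolding bij_betw_def by blast
    moreover from this have "1 \<le> t"
      using one_le_power[of "2::nat" D] by (auto intro: order_trans)
    ultimately show "basic_box B"
      using boxes[of t] by (simp add: T_def del: power_Suc)
  qed
  have partition: "partition_on unit_square ?Q"
    by (rule partition_onI) (auto simp: disjnt_def)
  have bx_root: "bx (Min T) = unit_square"
    unfolding Min_T using bx_eq[of 0 1] root by auto
  have "\<exists>T left right bx.
      rooted_binary_tree T left right \<and> (\<forall>t\<in>T. basic_box (bx t)) \<and> bx (Min T) = unit_square \<and>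
      (\<forall>t\<in>T - terminal_nodes T left right.
         bx t = bx (left t) \<union> bx (right t) \<and> bx (left t) \<inter> bx (right t) = {}) \<and>
      bij_betw bx (terminal_nodes T left right) ?Q"
  proof (rule exI[of _ T], rule exI[of _ left], rule exI[of _ right], rule exI[of _ bx], intro conjI)
    show "\<forall>t\<in>T. basic_box (bx t)"
      using boxes by blast
    show "\<forall>t\<in>T - terminal_nodes T left right.
        bx t = bx (left t) \<union> bx (right t) \<and> bx (left t) \<inter> bx (right t) = {}"
      using split by blast
    show "bij_betw bx (terminal_nodes T left right) ?Q"
      unfolding terminal by (rule bij)
  qed (fact tree bx_root)+
  then show ?thesis
    unfolding tree_structured_partition_def using finite partition basic by simp
qed

text \<open>A grid arises by bisecting \<open>p\<close> times in the first coordinate and then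
  \<open>q\<close> times in the second.\<close>

lemma tree_structured_partition_grid: "tree_structured_partition (grid p q)"
proof -
  \<comment> \<open>A leading digit \<open>1\<close>, then up to \<open>p\<close> digits of the
    first coordinate, then digits of the second.\<close>
  define c :: "nat \<Rightarrow> real \<times> real \<Rightarrow> nat" where
    "c d x = 2 ^ (d - p) * (2 ^ min d p + dyadic_index (min d p) (fst x)) + dyadic_index (d - p) (snd x)"
    for d x
  have fibre: "{x \<in> unit_square. c d x = t} =
      grid_box (min d p) (d - p) (t div 2 ^ (d - p) - 2 ^ min d p, t mod 2 ^ (d - p))"
    if "t \<in> {2 ^ d..<2 ^ Suc d}" for d t
  proof -
    have "(2::nat) ^ d = 2 ^ (d - p) * 2 ^ min d p"
      by (simp flip: power_add add: min_def)
    then have t: "2 ^ min d p \<le> t div 2 ^ (d - p)"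
      using that by (simp add: less_eq_div_iff_mult_less_eq mult.commute)
    have "c d x = t \<longleftrightarrow> dyadic_index (min d p) (fst x) = t div 2 ^ (d - p) - 2 ^ min d p
        \<and> dyadic_index (d - p) (snd x) = t mod 2 ^ (d - p)" if x: "x \<in> unit_square" for x
    proof
      have *: "dyadic_index (d - p) (snd x) < 2 ^ (d - p)"
        using x by (auto simp: unit_square_def intro!: dyadic_index_less)
      assume "c d x = t"
      then show "dyadic_index (min d p) (fst x) = t div 2 ^ (d - p) - 2 ^ min d p
        \<and> dyadic_index (d - p) (snd x) = t mod 2 ^ (d - p)"
        using * unfolding c_def by auto
    next
      assume "dyadic_index (min d p) (fst x) = t div 2 ^ (d - p) - 2 ^ min d p
        \<and> dyadic_index (d - p) (snd x) = t mod 2 ^ (d - p)"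
      then show "c d x = t"
        using t unfolding c_def by simp
    qed
    then show ?thesis
      by (auto simp: grid_box_def dyadic_address_def)
  qed
  have "tree_structured_partition ((\<lambda>x. {y \<in> unit_square. c (p + q) y = c (p + q) x}) ` unit_square)"
  proof (rule tree_structured_partition_heap)
    show "c 0 x = 1" if "x \<in> unit_square" for x
      using that by (auto simp: c_def dyadic_index_0 unit_square_def)
    show "c (Suc d) x div 2 = c d x" if "x \<in> unit_square" for x d
    proof (cases "d < p")
      case True
      then show ?thesis
        using that dyadic_index_add_div[of d 1 "fst x"]
        by (auto simp: c_def dyadic_index_0 unit_square_def min_def)
    next
      case False
      then have "Suc d - p = Suc (d - p)" "min (Suc d) p = p" "min d p = p" by auto
      then show ?thesis
        using dyadic_index_add_div[of "d - p" 1 "snd x"] by (simp add: c_def mult.assoc)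
    qed
    show "basic_box {x \<in> unit_square. c d x = t}" if "t \<in> {2 ^ d..<2 ^ Suc d}" for d t
      unfolding fibre[OF that]
    proof (rule basic_box_grid_box)
      have "(2::nat) ^ Suc d = 2 * 2 ^ min d p * 2 ^ (d - p)"
        by (simp flip: power_add add: min_def)
      then have "t div 2 ^ (d - p) < 2 * 2 ^ min d p"
        using that by (auto simp: div_less_iff_less_mult)
      then show "t div 2 ^ (d - p) - 2 ^ min d p < 2 ^ min d p"
        by (auto simp: less_diff_conv2)
    qed auto
  qed
  also have "(\<lambda>x. {y \<in> unit_square. c (p + q) y = c (p + q) x}) ` unit_square = grid p q"
    unfolding grid_def
  proof (rule image_cong[OF refl])
    fix x assume x: "x \<in> unit_square"
    have q: "dyadic_index q (snd y) < 2 ^ q" if "y \<in> unit_square" for y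
      using that by (auto simp: unit_square_def intro!: dyadic_index_less)
    have "c (p + q) y = c (p + q) x \<longleftrightarrow> dyadic_address p q y = dyadic_address p q x"
      if y: "y \<in> unit_square" for y
    proof
      assume eq: "c (p + q) y = c (p + q) x"
      have "c (p + q) z div 2 ^ q = 2 ^ p + dyadic_index p (fst z)"
        "c (p + q) z mod 2 ^ q = dyadic_index q (snd z)" if "z \<in> unit_square" for z
        using q[OF that] by (auto simp: c_def)
      from this(1)[OF x] this(1)[OF y] this(2)[OF x] this(2)[OF y] eq
      show "dyadic_address p q y = dyadic_address p q x"
        by (simp add: dyadic_address_def)
    qed (auto simp: c_def dyadic_address_def)
    then show "{y \<in> unit_square. c (p + q) y = c (p + q) x} = grid_box p q (dyadic_address p q x)"
      by (auto simp: grid_box_def)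
  qed
  finally show ?thesis .
qed

text \<open>Two points of a cell differ by at most the mesh in each coordinate.\<close>

lemma partition_norm_grid: "0 \<le> partition_norm (grid p q) \<and> partition_norm (grid p q) \<le> 1 / 2 ^ p + 1 / 2 ^ q"
proof -
  have dist: "dist y z \<le> 1 / 2 ^ p + 1 / 2 ^ q" if "y \<in> grid_box p q ij" "z \<in> grid_box p q ij" for y z ij
  proof -
    have coord: "\<bar>s - t\<bar> \<le> 1 / 2 ^ r"
      if "dyadic_index r s = dyadic_index r t" "0 \<le> s" "0 \<le> t" for s t r
      using that(1) dyadic_index_eq_iff[OF that(2), of r "dyadic_index r s"]
        dyadic_index_eq_iff[OF that(3), of r "dyadic_index r s"]
      by (auto simp: add_divide_distrib abs_le_iff)
    have "dist y z \<le> \<bar>fst y - fst z\<bar> + \<bar>snd y - snd z\<bar>"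
      unfolding dist_prod_def dist_real_def by (rule sqrt_sum_squares_le_sum_abs[THEN order_trans]) simp
    also have "\<dots> \<le> 1 / 2 ^ p + 1 / 2 ^ q"
      using that by (intro add_mono coord) (auto simp: grid_box_def dyadic_address_def unit_square_def)
    finally show ?thesis .
  qed
  have "partition_norm (grid p q) \<in> (\<lambda>x. diameter (cell (grid p q) x)) ` unit_square"
    unfolding partition_norm_def
  proof (rule Max_in)
    have "(\<lambda>x. diameter (cell (grid p q) x)) ` unit_square \<subseteq> diameter ` grid p q"
      using cell_grid by (auto simp: grid_def)
    then show "finite ((\<lambda>x. diameter (cell (grid p q) x)) ` unit_square)"
      using finite_subset finite_imageI[OF finite_grid] by blast
    have "(1/2, 1/2) \<in> unit_square" by (simp add: unit_square_def)
    then show "(\<lambda>x. diameter (cell (grid p q) x)) ` unit_square \<noteq> {}" by blast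
  qed
  then obtain x where x: "x \<in> unit_square"
    "partition_norm (grid p q) = diameter (grid_box p q (dyadic_address p q x))"
    using cell_grid by auto
  have bounded: "bounded (grid_box p q (dyadic_address p q x))"
    unfolding bounded_any_center[where a = x]
    using dist grid_box_self[OF x(1)] by blast
  have "diameter (grid_box p q (dyadic_address p q x)) \<le> 1 / 2 ^ p + 1 / 2 ^ q"
    using dist by (intro diameter_le) (auto simp flip: dist_norm simp del: dist_Pair_Pair)
  then show ?thesis
    using x diameter_ge_0[OF bounded] by simp
qed

lemma partition_norm_grid_tendsto_0:
  assumes "filterlim p at_top sequentially" "filterlim q at_top sequentially"
  shows "(\<lambda>N. partition_norm (grid (p N) (q N))) \<longlonglongrightarrow> 0"
proof -
  have half: "(\<lambda>n. 1 / 2 ^ n :: real) \<longlonglongrightarrow> 0"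
    using LIMSEQ_power_zero[of "1/2 :: real"] by (simp add: power_one_over)
  have "(\<lambda>N. 1 / 2 ^ p N + 1 / 2 ^ q N :: real) \<longlonglongrightarrow> 0 + 0"
    by (intro tendsto_add filterlim_compose[OF half] assms)
  then have upper: "(\<lambda>N. 1 / 2 ^ p N + 1 / 2 ^ q N :: real) \<longlonglongrightarrow> 0"
    by simp
  show ?thesis
    by (rule tendsto_sandwich[OF _ _ tendsto_const upper]) (simp_all add: partition_norm_grid)
qed

section \<open>The uniform distribution on dyadic boxes\<close>

text \<open>Probabilities of boxes are computed once, in \<open>emeasure_grid_box\<close>;
  unfolding them to quotients of Lebesgue measures would hide that rule from the simplifier.\<close>

declare emeasure_uniform_measure [simp del]

abbreviation uniform_square :: "(real \<times> real) measure" where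
  "uniform_square \<equiv> uniform_measure lborel unit_square"

lemma emeasure_lborel_Times:
  fixes A B :: "real set"
  assumes "A \<in> sets borel" "B \<in> sets borel"
  shows "emeasure lborel (A \<times> B) = emeasure lborel A * emeasure lborel B"
  using assms by (subst lborel_prod[symmetric]) (simp add: lborel.emeasure_pair_measure_Times)

lemma emeasure_unit_square: "emeasure lborel unit_square = 1"
  unfolding unit_square_def by (subst emeasure_lborel_Times) auto

lemma prob_space_uniform_square: "prob_space uniform_square"
  by (rule prob_space_uniform_measure) (simp_all add: emeasure_unit_square)

interpretation uniform_square: prob_space uniform_square
  by (rule prob_space_uniform_square)

lemma AE_uniform_square: "AE x in uniform_square. x \<in> unit_square"
  by (rule AE_uniform_measureI) auto

text \<open>The index set lies between an open and a closed interval of the same length; this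
  avoids a separate treatment of index \<open>0\<close>, whose left endpoint is missing.\<close>

lemma emeasure_dyadic_interval:
  assumes "k < 2 ^ r"
  shows "emeasure lborel {t \<in> {0<..<1}. dyadic_index r t = k} = ennreal (1 / 2 ^ r)"
proof -
  let ?T = "{t \<in> {0<..<1}. dyadic_index r t = k}"
  have [measurable]: "?T \<in> sets borel" by measurable
  have "real k + 1 \<le> 2 ^ r"
    using assms by (metis Suc_leI of_nat_Suc of_nat_le_iff of_nat_numeral of_nat_power add.commute)
  have "{real k / 2 ^ r<..<(real k + 1) / 2 ^ r} \<subseteq> ?T"
  proof (intro subsetI)
    fix t assume t: "t \<in> {real k / 2 ^ r<..<(real k + 1) / 2 ^ r}"
    have "0 < t"
      using t by (auto intro: le_less_trans[of 0 "real k / 2 ^ r"])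
    moreover have "t < 1"
      using t \<open>real k + 1 \<le> 2 ^ r\<close> by (auto intro: less_le_trans[of t "(real k + 1) / 2 ^ r"])
    ultimately show "t \<in> ?T"
      using t by (simp add: dyadic_index_eq_iff)
  qed
  then have "emeasure lborel {real k / 2 ^ r<..<(real k + 1) / 2 ^ r} \<le> emeasure lborel ?T"
    by (rule emeasure_mono) simp
  moreover have upper: "?T \<subseteq> {real k / 2 ^ r..(real k + 1) / 2 ^ r}"
  proof
    fix t assume "t \<in> ?T"
    then show "t \<in> {real k / 2 ^ r..(real k + 1) / 2 ^ r}"
      using dyadic_index_eq_iff[of t r k] by auto
  qed
  have "emeasure lborel ?T \<le> emeasure lborel {real k / 2 ^ r..(real k + 1) / 2 ^ r}"
    using upper by (rule emeasure_mono) simp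
  moreover have "(real k + 1) / 2 ^ r - real k / 2 ^ r = 1 / 2 ^ r"
    by (simp add: add_divide_distrib)
  ultimately show ?thesis
    by (intro antisym) (simp_all add: divide_right_mono)
qed

lemma emeasure_grid_box:
  assumes "i < 2 ^ p" "l < 2 ^ q"
  shows "emeasure uniform_square (grid_box p q (i, l)) = ennreal (1 / (2 ^ p * 2 ^ q))"
proof -
  have "grid_box p q (i, l) = {t \<in> {0<..<1}. dyadic_index p t = i} \<times> {t \<in> {0<..<1}. dyadic_index q t = l}"
    by (auto simp: grid_box_def dyadic_address_def unit_square_def)
  moreover have "{t \<in> {0<..<1}. dyadic_index r t = k} \<in> sets borel" for r k
    by measurable
  ultimately have "emeasure lborel (grid_box p q (i, l)) = ennreal (1 / 2 ^ p) * ennreal (1 / 2 ^ q)"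
    using assms by (simp only: emeasure_lborel_Times emeasure_dyadic_interval)
  moreover have "unit_square \<inter> grid_box p q (i, l) = grid_box p q (i, l)"
    by (auto simp: grid_box_def)
  ultimately show ?thesis
    by (simp add: emeasure_uniform_measure emeasure_unit_square divide_ennreal_def flip: ennreal_mult)
qed

text \<open>This turns bounds on probabilities into counting of addresses.\<close>

lemma emeasure_addresses_le:
  assumes "S \<subseteq> {..<2 ^ b} \<times> {..<2 ^ b}"
  shows "emeasure uniform_square {x \<in> unit_square. dyadic_address b b x \<in> S} \<le> ennreal (real (card S) / 4 ^ b)"
proof -
  have fin: "finite S"
    using assms finite_subset by blast
  have "{x \<in> unit_square. dyadic_address b b x \<in> S} = (\<Union>ij\<in>S. grid_box b b ij)"
    by (auto simp: grid_box_def)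
  also have "emeasure uniform_square \<dots> \<le> (\<Sum>ij\<in>S. emeasure uniform_square (grid_box b b ij))"
    using fin by (intro emeasure_subadditive_finite) auto
  also have "\<dots> = (\<Sum>ij\<in>S. ennreal (1 / 4 ^ b))"
    using assms by (intro sum.cong refl) (auto simp: emeasure_grid_box simp flip: power_mult_distrib)
  also have "\<dots> = ennreal (real (card S) / 4 ^ b)"
    by (simp add: ennreal_of_nat_eq_real_of_nat flip: ennreal_mult)
  finally show ?thesis .
qed

section \<open>Functions of small integral with large box means\<close>

text \<open>The union of the dyadic rectangles of area \<open>2^n\<close> with a corner at the
  origin, in a square of side \<open>2^n\<close>; up to a constant factor the region below the
  hyperbola \<open>i l = 2^n\<close>.\<close>

definition hyperbolic_cross :: "nat \<Rightarrow> (nat \<times> nat) set" where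
  "hyperbolic_cross n = {(i, l). \<exists>j\<le>n. i < 2 ^ (n - j) \<and> l < 2 ^ j}"

text \<open>Each rectangle but the last contributes the half that lies beyond the next, shorter
  one, so the cross has at least \<open>n 2^n / 2\<close> elements although each rectangle has
  only \<open>2^n\<close>. This gain of a factor \<open>n\<close> is the source of the divergence.\<close>

lemma card_outside_hyperbolic_cross:
  "real (card ({..<2 ^ n} \<times> {..<2 ^ n} - hyperbolic_cross n)) \<le> (1 - real n / 2 ^ Suc n) * 4 ^ n"
proof -
  \<comment> \<open>The right half of the \<open>j\<close>-th rectangle.\<close>
  define R where "R j = {2 ^ (n - Suc j)..<2 ^ (n - j) :: nat} \<times> {..<2 ^ j :: nat}" for j
  have card_R: "real (card (R j)) = 2 ^ n / 2" if jn: "j < n" for j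
  proof -
    obtain d where "n = Suc (j + d)"
      using less_imp_Suc_add[OF jn] by blast
    then have "R j = {2 ^ d..<2 ^ Suc d} \<times> {..<2 ^ j}" "n = Suc (j + d)"
      by (auto simp: R_def Suc_diff_le)
    then show ?thesis
      by (simp add: power_add)
  qed
  have disj: "R j \<inter> R k = {}" if "j < k" "k < n" for j k
  proof -
    have "(2::nat) ^ (n - k) \<le> 2 ^ (n - Suc j)"
      using that by (intro power_increasing) auto
    then show ?thesis by (auto simp: R_def simp del: power_increasing_iff)
  qed
  have sub: "(\<Union>j<n. R j) \<subseteq> ({..<2 ^ n} \<times> {..<2 ^ n}) \<inter> hyperbolic_cross n"
  proof
    fix z assume "z \<in> (\<Union>j<n. R j)"
    then obtain j i l where *: "j < n" "z = (i, l)" "i < 2 ^ (n - j)" "l < 2 ^ j"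
      by (auto simp: R_def)
    have "i < 2 ^ n" "l < 2 ^ n"
      using * by (auto intro: less_le_trans[of _ "2 ^ (n - j)"] less_le_trans[of _ "2 ^ j"])
    with * show "z \<in> ({..<2 ^ n} \<times> {..<2 ^ n}) \<inter> hyperbolic_cross n"
      by (auto simp: hyperbolic_cross_def intro!: exI[of _ j])
  qed
  have "card (\<Union>j<n. R j) = (\<Sum>j<n. card (R j))"
  proof (rule card_UN_disjoint)
    show "\<forall>i\<in>{..<n}. \<forall>j\<in>{..<n}. i \<noteq> j \<longrightarrow> R i \<inter> R j = {}"
      using disj by (metis Int_commute lessThan_iff linorder_neqE_nat)
  qed (auto simp: R_def)
  then have "real (card (\<Union>j<n. R j)) = real n * 2 ^ n / 2"
    by (simp add: card_R)
  moreover have "card (\<Union>j<n. R j) \<le> card (({..<2 ^ n} \<times> {..<2 ^ n}) \<inter> hyperbolic_cross n)"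
    using sub by (intro card_mono) auto
  moreover have "card ({..<2 ^ n} \<times> {..<2 ^ n} - hyperbolic_cross n) +
      card (({..<2 ^ n} \<times> {..<2 ^ n}) \<inter> hyperbolic_cross n) = card ({..<2 ^ n :: nat} \<times> {..<2 ^ n :: nat})"
    by (subst card_Un_disjoint[symmetric]) (auto simp: Un_Diff_Int)
  then have "real (card ({..<2 ^ n} \<times> {..<2 ^ n} - hyperbolic_cross n)) +
      real (card (({..<2 ^ n} \<times> {..<2 ^ n}) \<inter> hyperbolic_cross n)) = 4 ^ n"
    by (simp flip: of_nat_add add: power_mult_distrib[symmetric])
  moreover have "real n * 2 ^ n / 2 = real n / 2 ^ Suc n * 4 ^ n"
    by (simp add: field_simps flip: power_mult_distrib)
  ultimately show ?thesis
    by (simp add: algebra_simps)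
qed

lemma div_power_of_small_mod:
  fixes I :: nat
  assumes "I mod 2 ^ n < 2 ^ (n - j)" "j \<le> n"
  shows "I div 2 ^ n * 2 ^ n div 2 ^ (n - j) = I div 2 ^ (n - j)"
proof -
  have "(2::nat) ^ n = 2 ^ j * 2 ^ (n - j)"
    using assms(2) by (simp flip: power_add)
  then have eq: "I div 2 ^ n * 2 ^ n = (I div 2 ^ n * 2 ^ j) * 2 ^ (n - j)"
    by (simp add: mult.assoc)
  then have "I = (I div 2 ^ n * 2 ^ j) * 2 ^ (n - j) + I mod 2 ^ n"
    by (metis div_mult_mod_eq)
  then have "I div 2 ^ (n - j) = ((I div 2 ^ n * 2 ^ j) * 2 ^ (n - j) + I mod 2 ^ n) div 2 ^ (n - j)"
    by (rule arg_cong[where f = "\<lambda>x. x div 2 ^ (n - j)"])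
  also have "\<dots> = I div 2 ^ n * 2 ^ j"
    using assms(1) by simp
  finally have "I div 2 ^ (n - j) = I div 2 ^ n * 2 ^ j" .
  then show ?thesis
    by (subst eq) simp
qed

text \<open>What one more stage leaves of the addresses \<open>S\<close>: the quotients hold the
  old digits, the remainders the \<open>n\<close> new ones.\<close>

definition uncovered_addresses :: "nat \<Rightarrow> (nat \<times> nat) set \<Rightarrow> (nat \<times> nat) set" where
  "uncovered_addresses n S = {(i, l). (i div 2 ^ n, l div 2 ^ n) \<in> S \<and>
     (i mod 2 ^ n, l mod 2 ^ n) \<notin> hyperbolic_cross n}"

text \<open>An address is determined by its old and its new digits, so the two counts multiply.
  This is the independence of successive stages.\<close>

lemma card_uncovered_addresses:
  assumes "finite S"
  shows "finite (uncovered_addresses n S)"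
    and "real (card (uncovered_addresses n S)) \<le> real (card S) * ((1 - real n / 2 ^ Suc n) * 4 ^ n)"
proof -
  let ?B = "{..<2 ^ n} \<times> {..<2 ^ n} - hyperbolic_cross n"
  let ?g = "\<lambda>((i, l), (i', l')). (i * 2 ^ n + i', l * 2 ^ n + l')"
  have sub: "uncovered_addresses n S \<subseteq> ?g ` (S \<times> ?B)"
  proof
    fix z assume "z \<in> uncovered_addresses n S"
    then obtain i l where *: "z = (i, l)" "(i div 2 ^ n, l div 2 ^ n) \<in> S"
      "(i mod 2 ^ n, l mod 2 ^ n) \<notin> hyperbolic_cross n"
      by (auto simp: uncovered_addresses_def)
    show "z \<in> ?g ` (S \<times> ?B)"
      using * by (intro image_eqI[of _ _ "((i div 2 ^ n, l div 2 ^ n), (i mod 2 ^ n, l mod 2 ^ n))"])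
        (auto simp: div_mult_mod_eq)
  qed
  then show "finite (uncovered_addresses n S)"
    by (rule finite_subset) (use assms in simp)
  have "card (uncovered_addresses n S) \<le> card (?g ` (S \<times> ?B))"
    using sub assms by (intro card_mono) auto
  also have "\<dots> \<le> card (S \<times> ?B)"
    using assms by (intro card_image_le) auto
  also have "\<dots> = card S * card ?B"
    by (rule card_cartesian_product)
  finally have "real (card (uncovered_addresses n S)) \<le> real (card S) * real (card ?B)"
    by (simp flip: of_nat_mult)
  also have "\<dots> \<le> real (card S) * ((1 - real n / 2 ^ Suc n) * 4 ^ n)"
    by (intro mult_left_mono card_outside_hyperbolic_cross) simp
  finally show "real (card (uncovered_addresses n S)) \<le> real (card S) * ((1 - real n / 2 ^ Suc n) * 4 ^ n)" .
qed

text \<open>The lower left corner squares, of side \<open>2^-(b+n)\<close>, of all dyadic squares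
  of side \<open>2^-b\<close>: in both coordinates the \<open>n\<close> digits after the first
  \<open>b\<close> vanish.\<close>

definition corner_squares :: "nat \<Rightarrow> nat \<Rightarrow> (real \<times> real) set" where
  "corner_squares b n = {x \<in> unit_square. 2 ^ n dvd dyadic_index (b + n) (fst x) \<and> 2 ^ n dvd dyadic_index (b + n) (snd x)}"

lemma corner_squares_sets [measurable]: "corner_squares b n \<in> sets borel"
proof -
  have "corner_squares b n = {x \<in> unit_square. (\<lambda>(i, l). 2 ^ n dvd i \<and> 2 ^ n dvd l) (dyadic_address (b + n) (b + n) x)}"
    by (auto simp: corner_squares_def dyadic_address_def)
  then show ?thesis by (simp, measurable)
qed

lemma emeasure_corner_squares_le: "emeasure uniform_square (corner_squares b n) \<le> ennreal (1 / 4 ^ n)"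
proof -
  let ?S = "(\<lambda>(i, l). (i * 2 ^ n, l * 2 ^ n)) ` ({..<2 ^ b} \<times> {..<2 ^ b}) :: (nat \<times> nat) set"
  have "corner_squares b n \<subseteq> {x \<in> unit_square. dyadic_address (b + n) (b + n) x \<in> ?S}"
  proof
    fix x assume x: "x \<in> corner_squares b n"
    then have less: "dyadic_address (b + n) (b + n) x \<in> {..<2 ^ (b + n)} \<times> {..<2 ^ (b + n)}"
      by (intro dyadic_address_less) (simp add: corner_squares_def)
    obtain k l where kl: "dyadic_index (b + n) (fst x) = 2 ^ n * k" "dyadic_index (b + n) (snd x) = 2 ^ n * l"
      using x by (auto simp: corner_squares_def elim!: dvdE)
    have "dyadic_address (b + n) (b + n) x \<in> ?S"
      using less by (intro image_eqI[of _ _ "(k, l)"]) (auto simp: dyadic_address_def kl power_add)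
    then show "x \<in> {x \<in> unit_square. dyadic_address (b + n) (b + n) x \<in> ?S}"
      using x by (simp add: corner_squares_def)
  qed
  then have "emeasure uniform_square (corner_squares b n) \<le>
      emeasure uniform_square {x \<in> unit_square. dyadic_address (b + n) (b + n) x \<in> ?S}"
    by (rule emeasure_mono) measurable
  also have "\<dots> \<le> ennreal (real (card ?S) / 4 ^ (b + n))"
    by (rule emeasure_addresses_le) (auto simp: power_add)
  also have "\<dots> \<le> ennreal (1 / 4 ^ n)"
  proof (rule ennreal_leI)
    have "card ?S \<le> card ({..<2 ^ b :: nat} \<times> {..<2 ^ b :: nat})"
      by (rule card_image_le) auto
    also have "\<dots> = 4 ^ b"
      by (simp flip: power_mult_distrib)
    finally have "real (card ?S) \<le> 4 ^ b"
      by (metis of_nat_le_iff of_nat_numeral of_nat_power)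
    then show "real (card ?S) / 4 ^ (b + n) \<le> 1 / 4 ^ n"
      by (simp add: power_add divide_simps)
  qed
  finally show ?thesis .
qed

text \<open>If the new digits of \<open>x\<close> lie in the cross, then for some \<open>j\<close>
  the first \<open>j\<close> new digits of one coordinate and the first \<open>n - j\<close> of
  the other vanish. The grid cell of \<open>x\<close> of that resolution has area
  \<open>2^-n\<close> relative to the surrounding dyadic square and contains its corner square, of
  relative area \<open>4^-n\<close>. The height \<open>w 2^n\<close> on the corner square thus
  gives the mean \<open>w\<close>.\<close>

lemma large_mean_at_covered_address:
  assumes x: "x \<in> unit_square" and w: "0 \<le> w"
    and cross: "(dyadic_index (b + n) (fst x) mod 2 ^ n, dyadic_index (b + n) (snd x) mod 2 ^ n) \<in> hyperbolic_cross n"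
  shows "\<exists>p\<in>{b..b + n}. \<exists>q\<in>{b..b + n}.
    ennreal w * emeasure uniform_square (grid_box p q (dyadic_address p q x)) \<le>
    (\<integral>\<^sup>+y\<in>grid_box p q (dyadic_address p q x). ennreal (w * 2 ^ n) * indicator (corner_squares b n) y \<partial>uniform_square)"
proof -
  define I where "I = dyadic_index (b + n) (fst x)"
  define J where "J = dyadic_index (b + n) (snd x)"
  obtain j where j: "j \<le> n" "I mod 2 ^ n < 2 ^ (n - j)" "J mod 2 ^ n < 2 ^ j"
    using cross unfolding hyperbolic_cross_def I_def J_def by auto
  define p where "p = b + j"
  define q where "q = b + (n - j)"
  let ?R = "grid_box p q (dyadic_address p q x)"
  \<comment> \<open>The corner square in the dyadic square around \<open>x\<close>.\<close>
  let ?C = "grid_box (b + n) (b + n) (I div 2 ^ n * 2 ^ n, J div 2 ^ n * 2 ^ n)"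
  have index_p: "dyadic_index p t = dyadic_index (b + n) t div 2 ^ (n - j)" for t
    using dyadic_index_add_div[of p "n - j" t] j(1) by (simp add: p_def)
  have index_q: "dyadic_index q t = dyadic_index (b + n) t div 2 ^ j" for t
    using dyadic_index_add_div[of q j t] j(1) by (simp add: q_def)
  have I: "I div 2 ^ n * 2 ^ n div 2 ^ (n - j) = I div 2 ^ (n - j)"
    using j by (intro div_power_of_small_mod)
  have J: "J div 2 ^ n * 2 ^ n div 2 ^ j = J div 2 ^ j"
    using div_power_of_small_mod[of J n "n - j"] j by simp
  have "?C \<subseteq> corner_squares b n \<inter> ?R"
    using I J by (auto simp: grid_box_def corner_squares_def dyadic_address_def index_p index_q I_def J_def)
  then have C: "indicator ?C y \<le> (indicator (corner_squares b n) y * indicator ?R y :: ennreal)" for y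
    by (auto simp: indicator_def)
  have "I < 2 ^ (b + n)" "J < 2 ^ (b + n)"
    using dyadic_address_less[OF x, of "b + n" "b + n"] by (auto simp: dyadic_address_def I_def J_def)
  then have less: "I div 2 ^ n * 2 ^ n < 2 ^ (b + n)" "J div 2 ^ n * 2 ^ n < 2 ^ (b + n)"
    by (auto intro: le_less_trans[OF div_times_less_eq_dividend])
  have "emeasure uniform_square ?R = ennreal (1 / (2 ^ p * 2 ^ q))"
    using dyadic_address_less[OF x, of p q] by (cases "dyadic_address p q x") (auto simp: emeasure_grid_box)
  moreover have "(2::real) ^ p * 2 ^ q * 2 ^ n = 2 ^ (b + n) * 2 ^ (b + n)"
    using j(1) by (simp add: p_def q_def flip: power_add)
  then have "w * (1 / (2 ^ p * 2 ^ q)) = w * 2 ^ n * (1 / (2 ^ (b + n) * 2 ^ (b + n)))"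
    by (simp add: field_simps)
  ultimately have "ennreal w * emeasure uniform_square ?R = ennreal (w * 2 ^ n) * emeasure uniform_square ?C"
    using w by (simp only: emeasure_grid_box[OF less] flip: ennreal_mult) (simp flip: ennreal_mult)
  also have "\<dots> = (\<integral>\<^sup>+y. ennreal (w * 2 ^ n) * indicator ?C y \<partial>uniform_square)"
    by (simp add: nn_integral_cmult_indicator)
  also have "\<dots> \<le> (\<integral>\<^sup>+y\<in>?R. ennreal (w * 2 ^ n) * indicator (corner_squares b n) y \<partial>uniform_square)"
    using C by (intro nn_integral_mono) (auto simp: mult.assoc intro!: mult_left_mono)
  finally show ?thesis
    using j(1) by (intro bexI[of _ p] bexI[of _ q]) (auto simp: p_def q_def)
qed

text \<open>Each stage refines the previous one by \<open>n\<close> digits per coordinate, adds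
  \<open>w / 2^n\<close> to the integral and multiplies the proportion of uncovered addresses by
  at most \<open>1 - n / 2^(n+1)\<close>. The set \<open>S\<close> contains the addresses for
  which no mean of size \<open>w\<close> has been found yet.\<close>

lemma large_means_after_stages:
  fixes w :: real
  assumes w: "0 \<le> w"
  shows "\<exists>b S f. a \<le> b \<and> S \<subseteq> {..<2 ^ b} \<times> {..<2 ^ b} \<and>
     real (card S) \<le> (1 - real n / 2 ^ Suc n) ^ r * 4 ^ b \<and>
     f \<in> borel_measurable borel \<and> (\<integral>\<^sup>+x. f x \<partial>uniform_square) \<le> ennreal (real r * (w / 2 ^ n)) \<and>
     (\<forall>x\<in>unit_square. dyadic_address b b x \<notin> S \<longrightarrow> (\<exists>p\<in>{a..b}. \<exists>q\<in>{a..b}.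
        ennreal w * emeasure uniform_square (grid_box p q (dyadic_address p q x)) \<le>
        (\<integral>\<^sup>+y\<in>grid_box p q (dyadic_address p q x). f y \<partial>uniform_square)))"
proof (induction r)
  case 0
  show ?case
    using dyadic_address_less by (intro exI[of _ a] exI[of _ "{..<2 ^ a} \<times> {..<2 ^ a}"] exI[of _ "\<lambda>_. 0"])
      (auto simp flip: power_mult_distrib)
next
  case (Suc r)
  then obtain b S f where ab: "a \<le> b" and S: "S \<subseteq> {..<2 ^ b} \<times> {..<2 ^ b}"
    and card_S: "real (card S) \<le> (1 - real n / 2 ^ Suc n) ^ r * 4 ^ b"
    and f [measurable]: "f \<in> borel_measurable borel"
    and int_f: "(\<integral>\<^sup>+x. f x \<partial>uniform_square) \<le> ennreal (real r * (w / 2 ^ n))"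
    and covered: "\<And>x. x \<in> unit_square \<Longrightarrow> dyadic_address b b x \<notin> S \<Longrightarrow> (\<exists>p\<in>{a..b}. \<exists>q\<in>{a..b}.
        ennreal w * emeasure uniform_square (grid_box p q (dyadic_address p q x)) \<le>
        (\<integral>\<^sup>+y\<in>grid_box p q (dyadic_address p q x). f y \<partial>uniform_square))"
    by blast
  have fin: "finite S"
    using S finite_subset by blast
  define S' where "S' = uncovered_addresses n S"
  define g :: "real \<times> real \<Rightarrow> ennreal" where "g y = ennreal (w * 2 ^ n) * indicator (corner_squares b n) y" for y
  have [measurable]: "g \<in> borel_measurable borel"
    unfolding g_def[abs_def] by measurable
  show ?case
  proof (intro exI[of _ "b + n"] exI[of _ S'] exI[of _ "\<lambda>y. f y + g y"] conjI ballI impI)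
    show "a \<le> b + n" using ab by simp
    show "S' \<subseteq> {..<2 ^ (b + n)} \<times> {..<2 ^ (b + n)}"
      using S by (auto simp: S'_def uncovered_addresses_def power_add div_less_iff_less_mult)
    have p: "0 \<le> (1 - real n / 2 ^ Suc n) * 4 ^ n"
      using card_outside_hyperbolic_cross[of n] order_trans of_nat_0_le_iff by blast
    have "real (card S') \<le> real (card S) * ((1 - real n / 2 ^ Suc n) * 4 ^ n)"
      unfolding S'_def using fin by (rule card_uncovered_addresses)
    also have "\<dots> \<le> ((1 - real n / 2 ^ Suc n) ^ r * 4 ^ b) * ((1 - real n / 2 ^ Suc n) * 4 ^ n)"
      using card_S p by (rule mult_right_mono)
    also have "\<dots> = (1 - real n / 2 ^ Suc n) ^ Suc r * 4 ^ (b + n)"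
      by (simp only: power_Suc power_add mult_ac)
    finally show "real (card S') \<le> (1 - real n / 2 ^ Suc n) ^ Suc r * 4 ^ (b + n)" .
    show "(\<lambda>y. f y + g y) \<in> borel_measurable borel" by measurable
    have "(\<integral>\<^sup>+x. g x \<partial>uniform_square) = ennreal (w * 2 ^ n) * emeasure uniform_square (corner_squares b n)"
      unfolding g_def by (simp add: nn_integral_cmult_indicator)
    also have "\<dots> \<le> ennreal (w * 2 ^ n) * ennreal (1 / 4 ^ n)"
      by (intro mult_left_mono emeasure_corner_squares_le) simp
    also have "\<dots> = ennreal (w / 2 ^ n)"
      using w power_mult_distrib[of "2::real" 2 n] by (simp flip: ennreal_mult)
    finally have "(\<integral>\<^sup>+x. f x + g x \<partial>uniform_square) \<le> ennreal (real r * (w / 2 ^ n)) + ennreal (w / 2 ^ n)"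
      using int_f by (subst nn_integral_add) (auto intro: add_mono)
    also have "\<dots> = ennreal (real (Suc r) * (w / 2 ^ n))"
      using w by (simp add: algebra_simps add_divide_distrib flip: ennreal_plus)
    finally show "(\<integral>\<^sup>+x. f x + g x \<partial>uniform_square) \<le> ennreal (real (Suc r) * (w / 2 ^ n))" .
    fix x assume x: "x \<in> unit_square" "dyadic_address (b + n) (b + n) x \<notin> S'"
    have address: "dyadic_address b b x =
        (dyadic_index (b + n) (fst x) div 2 ^ n, dyadic_index (b + n) (snd x) div 2 ^ n)"
      by (simp add: dyadic_address_def dyadic_index_add_div)
    have mono: "(\<integral>\<^sup>+y\<in>B. u y \<partial>uniform_square) \<le> (\<integral>\<^sup>+y\<in>B. f y + g y \<partial>uniform_square)"
      if "u = f \<or> u = g" for u B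
      using that by (intro nn_integral_mono) (auto simp: distrib_right)
    have "\<exists>u\<in>{f, g}. \<exists>p\<in>{a..b + n}. \<exists>q\<in>{a..b + n}.
        ennreal w * emeasure uniform_square (grid_box p q (dyadic_address p q x)) \<le>
        (\<integral>\<^sup>+y\<in>grid_box p q (dyadic_address p q x). u y \<partial>uniform_square)"
    proof (cases "dyadic_address b b x \<in> S")
      case False
      from covered[OF x(1) this] show ?thesis by fastforce
    next
      case True
      then have "(dyadic_index (b + n) (fst x) mod 2 ^ n, dyadic_index (b + n) (snd x) mod 2 ^ n) \<in> hyperbolic_cross n"
        using x(2) address by (simp add: S'_def uncovered_addresses_def dyadic_address_def)
      from large_mean_at_covered_address[OF x(1) w this] ab show ?thesis
        unfolding g_def[symmetric] by fastforce
    qed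
    then show "\<exists>p\<in>{a..b + n}. \<exists>q\<in>{a..b + n}.
        ennreal w * emeasure uniform_square (grid_box p q (dyadic_address p q x)) \<le>
        (\<integral>\<^sup>+y\<in>grid_box p q (dyadic_address p q x). f y + g y \<partial>uniform_square)"
      using mono by (blast intro: order_trans)
  qed
qed

text \<open>With \<open>r\<close> stages the integral is at most \<open>r w / 2^n\<close>, and the
  uncovered part at most \<open>exp (- r n / 2^(n+1))\<close>. Keeping \<open>r / 2^n\<close>
  fixed and letting \<open>n\<close> grow makes the second arbitrarily small without changing the
  first.\<close>

lemma large_means_off_small_set:
  "\<exists>b f N. f \<in> borel_measurable borel \<and> (\<integral>\<^sup>+x. f x \<partial>uniform_square) \<le> ennreal ((1/2) ^ m) \<and>
     m \<le> b \<and> N \<in> sets borel \<and> emeasure uniform_square N \<le> ennreal ((1/2) ^ m) \<and>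
     (\<forall>x\<in>unit_square - N. \<exists>p\<in>{m..b}. \<exists>q\<in>{m..b}.
        ennreal (2 ^ m) * emeasure uniform_square (grid_box p q (dyadic_address p q x)) \<le>
        (\<integral>\<^sup>+y\<in>grid_box p q (dyadic_address p q x). f y \<partial>uniform_square))"
proof -
  \<comment> \<open>These choices give \<open>r / 2^n = 4^-m\<close> and \<open>r n / 2^(n+1)
    \<ge> m\<close>.\<close>
  define n where "n = 2 * m * 4 ^ m + 2 * m"
  define r :: nat where "r = 2 ^ (n - 2 * m)"
  have r: "real r / 2 ^ n = 1 / 4 ^ m"
  proof -
    have "(2::real) ^ n = 2 ^ (n - 2 * m) * 2 ^ (2 * m)"
      unfolding n_def by (simp flip: power_add)
    then show ?thesis by (simp add: r_def power_mult)
  qed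
  from large_means_after_stages[of "2 ^ m" m n r] obtain b S f where mb: "m \<le> b"
    and S: "S \<subseteq> {..<2 ^ b} \<times> {..<2 ^ b}"
    and card_S: "real (card S) \<le> (1 - real n / 2 ^ Suc n) ^ r * 4 ^ b"
    and f: "f \<in> borel_measurable borel"
    and int_f: "(\<integral>\<^sup>+x. f x \<partial>uniform_square) \<le> ennreal (real r * (2 ^ m / 2 ^ n))"
    and covered: "\<forall>x\<in>unit_square. dyadic_address b b x \<notin> S \<longrightarrow> (\<exists>p\<in>{m..b}. \<exists>q\<in>{m..b}.
        ennreal (2 ^ m) * emeasure uniform_square (grid_box p q (dyadic_address p q x)) \<le>
        (\<integral>\<^sup>+y\<in>grid_box p q (dyadic_address p q x). f y \<partial>uniform_square))"
    by auto
  define N where "N = {x \<in> unit_square. dyadic_address b b x \<in> S}"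
  have "real r * (2 ^ m / 2 ^ n) = real r / 2 ^ n * 2 ^ m" by simp
  also have "\<dots> = (1/2) ^ m"
    unfolding r using power_mult_distrib[of "2::real" 2 m] by (simp add: power_one_over)
  finally have int_f': "(\<integral>\<^sup>+x. f x \<partial>uniform_square) \<le> ennreal ((1/2) ^ m)"
    using int_f by simp
  have "real n \<le> 2 ^ Suc n"
    using of_nat_less_two_power[of n, where 'a = real] by (simp add: less_imp_le order_trans[of _ "2 ^ n"])
  then have "(1 - real n / 2 ^ Suc n) ^ r \<le> exp (- (real n / 2 ^ Suc n)) ^ r"
    using exp_ge_add_one_self[of "- (real n / 2 ^ Suc n)"] by (intro power_mono) (simp_all add: divide_simps)
  also have "\<dots> = exp (- (real r / 2 ^ n * real n / 2))"
    by (simp flip: exp_of_nat_mult)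
  also have "\<dots> \<le> exp (- real m)"
  proof -
    have "real m \<le> 1 / 4 ^ m * real n / 2"
      unfolding n_def by (simp add: field_simps)
    then show ?thesis
      by (simp only: r exp_le_cancel_iff neg_le_iff_le)
  qed
  also have "\<dots> = exp (- 1) ^ m"
    by (simp flip: exp_of_nat_mult)
  also have "\<dots> \<le> (1/2) ^ m"
    using exp_ge_add_one_self[of 1] by (intro power_mono) (simp_all add: exp_minus inverse_eq_divide divide_simps)
  finally have "(1 - real n / 2 ^ Suc n) ^ r * 4 ^ b \<le> (1/2) ^ m * 4 ^ b"
    by (rule mult_right_mono) simp
  with card_S have "real (card S) \<le> (1/2) ^ m * 4 ^ b"
    by (rule order_trans)
  then have "real (card S) / 4 ^ b \<le> (1/2) ^ m"
    by (simp add: divide_le_eq)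
  then have "emeasure uniform_square N \<le> ennreal ((1/2) ^ m)"
    unfolding N_def using emeasure_addresses_le[OF S] by (meson ennreal_leI order_trans)
  moreover have "N \<in> sets borel"
    unfolding N_def by measurable
  ultimately show ?thesis
    using mb f int_f' covered unfolding N_def
    by (intro exI[of _ b] exI[of _ f] exI[of _ "{x \<in> unit_square. dyadic_address b b x \<in> S}"]) auto
qed

section \<open>An integrable function with divergent box means\<close>

definition box_mean :: "(real \<times> real \<Rightarrow> real) \<Rightarrow> (real \<times> real) set \<Rightarrow> real" where
  "box_mean h B = (\<integral>x. h x * indicator B x \<partial>uniform_square) / measure uniform_square B"

text \<open>The sum of the functions obtained for \<open>m = 0, 1, 2, \<dots>\<close> has a finite
  integral. Since all of them are nonnegative, the mean of the sum is at least \<open>2^m\<close>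
  wherever the mean of the \<open>m\<close>-th one is, and by the Borel-Cantelli lemma almost
  every point escapes all but finitely many of the exceptional sets. The grids used for
  \<open>m\<close> have both resolutions at least \<open>m\<close>, so only finitely many of all
  the grids are coarser than a given one; hence any enumeration without repetition has mesh
  tending to \<open>0\<close>.\<close>

lemma divergent_box_means:
  obtains h :: "real \<times> real \<Rightarrow> real" and g :: "nat \<Rightarrow> nat \<times> nat"
  where "h \<in> borel_measurable borel" "integrable uniform_square h"
    "filterlim (\<lambda>k. fst (g k)) at_top sequentially" "filterlim (\<lambda>k. snd (g k)) at_top sequentially"
    "AE x in uniform_square. \<forall>K. \<exists>k. K \<le> box_mean h (cell (grid (fst (g k)) (snd (g k))) x)"
proof -
  have "\<forall>m. \<exists>b f N. f \<in> borel_measurable borel \<and> (\<integral>\<^sup>+x. f x \<partial>uniform_square) \<le> ennreal ((1/2) ^ m) \<and>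
     m \<le> b \<and> N \<in> sets borel \<and> emeasure uniform_square N \<le> ennreal ((1/2) ^ m) \<and>
     (\<forall>x\<in>unit_square - N. \<exists>p\<in>{m..b}. \<exists>q\<in>{m..b}.
        ennreal (2 ^ m) * emeasure uniform_square (grid_box p q (dyadic_address p q x)) \<le>
        (\<integral>\<^sup>+y\<in>grid_box p q (dyadic_address p q x). f y \<partial>uniform_square))"
    using large_means_off_small_set by blast
  then obtain b f N where f [measurable]: "\<And>m. f m \<in> borel_measurable borel"
    and int_f: "\<And>m. (\<integral>\<^sup>+x. f m x \<partial>uniform_square) \<le> ennreal ((1/2) ^ m)"
    and b: "\<And>m. m \<le> b m"
    and N [measurable]: "\<And>m. N m \<in> sets borel"
    and N_le: "\<And>m. emeasure uniform_square (N m) \<le> ennreal ((1/2) ^ m)"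
    and large: "\<And>m x. x \<in> unit_square - N m \<Longrightarrow> \<exists>p\<in>{m..b m}. \<exists>q\<in>{m..b m}.
        ennreal (2 ^ m) * emeasure uniform_square (grid_box p q (dyadic_address p q x)) \<le>
        (\<integral>\<^sup>+y\<in>grid_box p q (dyadic_address p q x). f m y \<partial>uniform_square)"
    unfolding choice_iff by blast
  define H where "H x = (\<Sum>m. f m x)" for x
  define h where "h x = enn2real (H x)" for x
  have [measurable]: "H \<in> borel_measurable borel" "h \<in> borel_measurable borel"
    unfolding H_def[abs_def] h_def[abs_def] by measurable
  have "(\<integral>\<^sup>+x. H x \<partial>uniform_square) = (\<Sum>m. \<integral>\<^sup>+x. f m x \<partial>uniform_square)"
    unfolding H_def by (rule nn_integral_suminf) measurable
  also have "\<dots> \<le> (\<Sum>m. ennreal ((1/2) ^ m))"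
    using int_f by (intro suminf_le) auto
  also have "\<dots> < \<infinity>"
    by (subst suminf_ennreal2) (auto simp: summable_geometric)
  finally have int_H: "(\<integral>\<^sup>+x. H x \<partial>uniform_square) < \<infinity>" .
  then have "AE x in uniform_square. H x \<noteq> \<infinity>"
    by (intro nn_integral_PInf_AE) auto
  then have h_H: "AE x in uniform_square. ennreal (h x) = H x"
    by eventually_elim (simp add: h_def top.not_eq_extremum)
  have h_nonneg: "0 \<le> h x" for x
    by (simp add: h_def)
  have int_h: "integrable uniform_square h"
  proof (rule integrableI_nonneg)
    have "(\<integral>\<^sup>+x. ennreal (h x) \<partial>uniform_square) = (\<integral>\<^sup>+x. H x \<partial>uniform_square)"
      using h_H by (rule nn_integral_cong_AE)
    then show "(\<integral>\<^sup>+x. ennreal (h x) \<partial>uniform_square) < \<infinity>"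
      using int_H by simp
  qed (use h_nonneg in auto)

  define P where "P = (\<Union>m. {m..b m} \<times> {m..b m})"
  define g where "g = from_nat_into P"
  have "range (\<lambda>m. (m, m)) \<subseteq> P"
    using b by (auto simp: P_def)
  moreover have "infinite (range (\<lambda>m::nat. (m, m)))"
    by (rule range_inj_infinite) (auto simp: inj_def)
  ultimately have "infinite P"
    using finite_subset by blast
  then have bij: "bij_betw g UNIV P"
    unfolding g_def by (intro bij_betw_from_nat_into) (auto simp: P_def)
  have fin: "finite {k. fst (g k) < z \<or> snd (g k) < z}" for z
  proof (rule finite_imageD)
    have "g ` {k. fst (g k) < z \<or> snd (g k) < z} \<subseteq> (\<Union>m<z. {m..b m} \<times> {m..b m})"
    proof
      fix y assume "y \<in> g ` {k. fst (g k) < z \<or> snd (g k) < z}"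
      then have y: "y \<in> P" "fst y < z \<or> snd y < z"
        using bij by (auto simp: bij_betw_def)
      then obtain m where "y \<in> {m..b m} \<times> {m..b m}"
        by (auto simp: P_def)
      with y show "y \<in> (\<Union>m<z. {m..b m} \<times> {m..b m})"
        by (auto intro!: bexI[of _ m])
    qed
    then show "finite (g ` {k. fst (g k) < z \<or> snd (g k) < z})"
      by (rule finite_subset) auto
    show "inj_on g {k. fst (g k) < z \<or> snd (g k) < z}"
      using bij by (auto simp: bij_betw_def intro: inj_on_subset)
  qed
  show thesis
  proof (rule that[of h g])
    have ev: "\<forall>\<^sub>F k in sequentially. \<not> (fst (g k) < z \<or> snd (g k) < z)" for z
      using fin by (simp add: eventually_cofinite flip: cofinite_eq_sequentially)
    show "filterlim (\<lambda>k. fst (g k)) at_top sequentially" "filterlim (\<lambda>k. snd (g k)) at_top sequentially"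
      unfolding filterlim_at_top
    proof safe
      fix z
      show "\<forall>\<^sub>F k in sequentially. z \<le> fst (g k)" "\<forall>\<^sub>F k in sequentially. z \<le> snd (g k)"
        using ev[of z] by (eventually_elim, simp)+
    qed
    have "AE x in uniform_square. \<forall>\<^sub>F m in sequentially. x \<in> space uniform_square - N m"
    proof (rule borel_cantelli_AE1)
      have "measure uniform_square (N m) \<le> (1/2) ^ m" for m
        using N_le[of m] by (simp add: uniform_square.emeasure_eq_measure)
      then have "norm (measure uniform_square (N m)) \<le> (1/2) ^ m" for m
        by simp
      then show "summable (\<lambda>m. measure uniform_square (N m))"
        by (intro summable_comparison_test'[OF summable_geometric[of "1/2"]]) simp
      show "N m \<in> sets uniform_square" "emeasure uniform_square (N m) < \<infinity>" for m
        by (simp_all add: uniform_square.emeasure_eq_measure)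
    qed
    with AE_uniform_square
    show "AE x in uniform_square. \<forall>K. \<exists>k. K \<le> box_mean h (cell (grid (fst (g k)) (snd (g k))) x)"
    proof eventually_elim
      case (elim x)
      show ?case
      proof
        fix K :: real
        obtain m0 where m0: "K < 2 ^ m0"
          using real_arch_pow[of 2 K] by auto
        obtain m where m: "m0 \<le> m" "x \<notin> N m"
          using elim(2) unfolding eventually_sequentially by (metis DiffD2 nle_le)
        obtain p q where pq: "p \<in> {m..b m}" "q \<in> {m..b m}"
          and le: "ennreal (2 ^ m) * emeasure uniform_square (grid_box p q (dyadic_address p q x)) \<le>
            (\<integral>\<^sup>+y\<in>grid_box p q (dyadic_address p q x). f m y \<partial>uniform_square)"
          using large[of x m] elim(1) m(2) by blast
        let ?R = "grid_box p q (dyadic_address p q x)"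
        have "(p, q) \<in> P"
          using pq by (auto simp: P_def)
        then obtain k where k: "g k = (p, q)"
          using bij by (auto simp: bij_betw_def)
        have "emeasure uniform_square ?R = ennreal (1 / (2 ^ p * 2 ^ q))"
          using dyadic_address_less[OF elim(1), of p q]
          by (cases "dyadic_address p q x") (auto simp: emeasure_grid_box)
        then have pos: "0 < measure uniform_square ?R"
          by (simp add: uniform_square.emeasure_eq_measure)
        have int: "integrable uniform_square (\<lambda>y. h y * indicator ?R y)"
          using int_h by (rule integrable_real_mult_indicator[rotated]) simp
        note le
        also have "(\<integral>\<^sup>+y\<in>?R. f m y \<partial>uniform_square) \<le> (\<integral>\<^sup>+y\<in>?R. H y \<partial>uniform_square)"
        proof (intro nn_integral_mono mult_right_mono)
          show "f m y \<le> H y" for y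
            using sum_le_suminf[of "\<lambda>m. f m y" "{m}"] by (simp add: H_def)
        qed simp
        also have "\<dots> = (\<integral>\<^sup>+y. ennreal (h y * indicator ?R y) \<partial>uniform_square)"
          using h_H by (intro nn_integral_cong_AE) (auto elim!: eventually_mono simp: indicator_def)
        also have "\<dots> = ennreal (\<integral>y. h y * indicator ?R y \<partial>uniform_square)"
          using int h_nonneg by (intro nn_integral_eq_integral) auto
        finally have "2 ^ m * measure uniform_square ?R \<le> (\<integral>y. h y * indicator ?R y \<partial>uniform_square)"
          using h_nonneg by (simp add: uniform_square.emeasure_eq_measure flip: ennreal_mult)
        then have "2 ^ m \<le> box_mean h ?R"
          using pos by (simp add: box_mean_def field_simps)
        moreover have "K \<le> 2 ^ m"
          using m0 m(1) power_increasing[of m0 m "2::real"] by linarith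
        ultimately have "K \<le> box_mean h (cell (grid (fst (g k)) (snd (g k))) x)"
          using k cell_grid[OF elim(1), of p q] by simp
        then show "\<exists>k. K \<le> box_mean h (cell (grid (fst (g k)) (snd (g k))) x)" ..
      qed
    qed
  qed (use int_h in auto)
qed

section \<open>The strong law of large numbers\<close>

text \<open>The maximum of the partial sums of \<open>Z (\<omega> 0), Z (\<omega> 1),
  \<dots>\<close> with at most \<open>N\<close> terms, the empty sum included, written recursively
  along the shift.\<close>

primrec max_partial_sum :: "('a \<Rightarrow> real) \<Rightarrow> nat \<Rightarrow> (nat \<Rightarrow> 'a) \<Rightarrow> real" where
  "max_partial_sum Z 0 \<omega> = 0"
| "max_partial_sum Z (Suc N) \<omega> = max 0 (Z (\<omega> 0) + max_partial_sum Z N (\<lambda>i. \<omega> (Suc i)))"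

lemma max_partial_sum_nonneg: "0 \<le> max_partial_sum Z N \<omega>"
  by (cases N) auto

lemma max_partial_sum_mono_Suc: "max_partial_sum Z N \<omega> \<le> max_partial_sum Z (Suc N) \<omega>"
proof (induction N arbitrary: \<omega>)
  case (Suc N)
  show ?case
    using Suc[of "\<lambda>i. \<omega> (Suc i)"] unfolding max_partial_sum.simps(2) by (intro max.mono add_left_mono) auto
qed simp

lemma max_partial_sum_mono: "N \<le> N' \<Longrightarrow> max_partial_sum Z N \<omega> \<le> max_partial_sum Z N' \<omega>"
  by (rule lift_Suc_mono_le[of "\<lambda>N. max_partial_sum Z N \<omega>"]) (rule max_partial_sum_mono_Suc)

lemma partial_sum_le_max: "(\<Sum>i<N. Z (\<omega> i)) \<le> max_partial_sum Z N \<omega>"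
proof (induction N arbitrary: \<omega>)
  case (Suc N)
  show ?case
    using Suc[of "\<lambda>i. \<omega> (Suc i)"] by (simp add: sum.lessThan_Suc_shift del: sum.lessThan_Suc)
qed simp

context sequence_space
begin

interpretation MS: pair_prob_space M S ..

lemma distr_pair_snd: "distr (M \<Otimes>\<^sub>M S) S snd = S"
proof (rule measure_eqI)
  fix A assume A: "A \<in> sets (distr (M \<Otimes>\<^sub>M S) S snd)"
  then have "snd -` A \<inter> space (M \<Otimes>\<^sub>M S) = space M \<times> A"
    using sets.sets_into_space[of A S] by (auto simp: space_pair_measure)
  then show "emeasure (distr (M \<Otimes>\<^sub>M S) S snd) A = emeasure S A"
    using A by (simp add: emeasure_distr P.emeasure_pair_measure_Times M.emeasure_space_1)
qed simp

text \<open>Prepending an independent value to a sample sequence gives a sample sequence;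
  integration over sequences is therefore integration over the first value and the shifted
  sequence.\<close>

lemma integral_case_nat:
  fixes g :: "(nat \<Rightarrow> 'a) \<Rightarrow> real"
  assumes [measurable]: "g \<in> borel_measurable S"
  shows "integrable S g \<longleftrightarrow> integrable (M \<Otimes>\<^sub>M S) (\<lambda>(s, \<omega>). g (case_nat s \<omega>))"
    and "(\<integral>\<omega>. g \<omega> \<partial>S) = (\<integral>(s, \<omega>). g (case_nat s \<omega>) \<partial>(M \<Otimes>\<^sub>M S))"
proof -
  have [measurable]: "(\<lambda>(s, \<omega>). case_nat s \<omega>) \<in> M \<Otimes>\<^sub>M S \<rightarrow>\<^sub>M S"
    by measurable
  show "integrable S g \<longleftrightarrow> integrable (M \<Otimes>\<^sub>M S) (\<lambda>(s, \<omega>). g (case_nat s \<omega>))"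
    by (subst PiM_iter[symmetric], subst integrable_distr_eq) (auto simp: split_beta')
  show "(\<integral>\<omega>. g \<omega> \<partial>S) = (\<integral>(s, \<omega>). g (case_nat s \<omega>) \<partial>(M \<Otimes>\<^sub>M S))"
    by (subst PiM_iter[symmetric], subst integral_distr) (auto simp: split_beta')
qed

lemma max_partial_sum_measurable [measurable]:
  assumes [measurable]: "Z \<in> borel_measurable M"
  shows "max_partial_sum Z N \<in> borel_measurable S"
proof (induction N)
  case (Suc N)
  note [measurable] = Suc
  have "(\<lambda>\<omega>. (\<lambda>i. \<omega> (Suc i))) \<in> S \<rightarrow>\<^sub>M S"
    by (rule measurable_PiM_single') (auto simp: space_PiM)
  note [measurable] = measurable_compose[OF this Suc]
  show ?case by simp
qed simp

lemma integrable_case_nat_fst: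
  fixes Z :: "'a \<Rightarrow> real"
  assumes "integrable M Z"
  shows "integrable (M \<Otimes>\<^sub>M S) (\<lambda>(s, \<omega>). Z s)"
proof -
  have [measurable]: "Z \<in> borel_measurable M" using assms by auto
  have *: "distr (M \<Otimes>\<^sub>M S) M fst = M"
    by (intro P.distr_pair_fst)
  have "integrable (distr (M \<Otimes>\<^sub>M S) M fst) Z"
    unfolding * by (fact assms)
  then show ?thesis
    by (subst (asm) integrable_distr_eq) (auto simp: split_beta')
qed

lemma integrable_case_nat_snd:
  fixes g :: "(nat \<Rightarrow> 'a) \<Rightarrow> real"
  assumes "integrable S g"
  shows "integrable (M \<Otimes>\<^sub>M S) (\<lambda>(s, \<omega>). g \<omega>)"
    and "(\<integral>(s, \<omega>). g \<omega> \<partial>(M \<Otimes>\<^sub>M S)) = (\<integral>\<omega>. g \<omega> \<partial>S)"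
proof -
  have [measurable]: "g \<in> borel_measurable S" using assms by auto
  show "integrable (M \<Otimes>\<^sub>M S) (\<lambda>(s, \<omega>). g \<omega>)"
    using assms by (subst (asm) distr_pair_snd[symmetric], subst (asm) integrable_distr_eq) (auto simp: split_beta')
  show "(\<integral>(s, \<omega>). g \<omega> \<partial>(M \<Otimes>\<^sub>M S)) = (\<integral>\<omega>. g \<omega> \<partial>S)"
    by (subst (2) distr_pair_snd[symmetric], subst integral_distr) (auto simp: split_beta')
qed

lemma integrable_max_partial_sum:
  assumes "integrable M Z"
  shows "integrable S (max_partial_sum Z N)"
proof (induction N)
  case (Suc N)
  have [measurable]: "Z \<in> borel_measurable M" using assms by auto
  have "integrable (M \<Otimes>\<^sub>M S) (\<lambda>(s, \<omega>). max 0 (Z s + max_partial_sum Z N \<omega>))"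
    using integrable_case_nat_fst[OF assms] integrable_case_nat_snd(1)[OF Suc]
    by (auto simp: split_beta')
  then show ?case
    by (subst integral_case_nat(1)) (auto simp del: max_partial_sum.simps simp: max_partial_sum.simps(2))
qed simp

text \<open>Let \<open>D\<close> be the set where the partial sums are unbounded above; it is
  invariant under the shift. The maxima \<open>M N\<close> increase with \<open>N\<close>, and the
  shift preserves the measure, so the integral over \<open>D\<close> of \<open>M (Suc N)\<close>
  minus the shifted \<open>M N\<close> is nonnegative. By the recursion this difference is the
  maximum of \<open>Z (\<omega> 0)\<close> and the negative of the shifted \<open>M N\<close>,
  which on \<open>D\<close> tends to \<open>Z (\<omega> 0)\<close>. Hence \<open>Z (\<omega>
  0)\<close> has a nonnegative integral over \<open>D\<close>. But \<open>D\<close> depends only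
  on the shifted sequence, so this integral is the negative mean of \<open>Z\<close> times the
  probability of \<open>D\<close>, which must be \<open>0\<close>.\<close>

lemma AE_bdd_above_partial_sums:
  fixes Z :: "'a \<Rightarrow> real"
  assumes int: "integrable M Z" and neg: "(\<integral>z. Z z \<partial>M) < 0"
  shows "AE \<omega> in S. bdd_above (range (\<lambda>N. \<Sum>i<N. Z (\<omega> i)))"
proof -
  have [measurable]: "Z \<in> borel_measurable M" using int by auto
  let ?m = "max_partial_sum Z"
  define D where "D = {\<omega> \<in> space S. \<forall>k::nat. \<exists>N. real k \<le> ?m N \<omega>}"
  have [measurable]: "D \<in> sets S"
    unfolding D_def by measurable
  have unbounded: "\<exists>N. K \<le> ?m N \<omega>" if "\<omega> \<in> D" for K \<omega>
    using that real_arch_simple[of K] unfolding D_def by (blast intro: order_trans)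
  have shift: "case_nat s \<omega> \<in> D \<longleftrightarrow> \<omega> \<in> D" if "s \<in> space M" "\<omega> \<in> space S" for s \<omega>
  proof
    have sp: "case_nat s \<omega> \<in> space S"
      using that by (auto simp: space_PiM PiE_iff split: nat.split)
    assume D: "\<omega> \<in> D"
    have "\<exists>N. real k \<le> ?m N (case_nat s \<omega>)" for k
    proof -
      obtain N where "real k - Z s \<le> ?m N \<omega>" using unbounded[OF D] by blast
      then show ?thesis by (intro exI[of _ "Suc N"]) simp
    qed
    then show "case_nat s \<omega> \<in> D" using sp by (simp add: D_def)
  next
    assume D: "case_nat s \<omega> \<in> D"
    have "\<exists>N. real k \<le> ?m N \<omega>" for k
    proof -
      obtain N where N: "real k + \<bar>Z s\<bar> + 1 \<le> ?m N (case_nat s \<omega>)" using unbounded[OF D] by blast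
      then obtain N' where "N = Suc N'" by (cases N) auto
      with N have "real k \<le> ?m N' \<omega>" by (auto simp: max_def split: if_splits)
      then show ?thesis by blast
    qed
    then show "\<omega> \<in> D" using that by (simp add: D_def)
  qed
  define g where "g N = (\<lambda>(s, \<omega>). indicator D \<omega> * max (- ?m N \<omega>) (Z s))" for N
  have [measurable]: "g N \<in> borel_measurable (M \<Otimes>\<^sub>M S)" for N
    unfolding g_def by measurable
  have intZ: "integrable (M \<Otimes>\<^sub>M S) (\<lambda>(s, \<omega>). Z s)"
    using int by (rule integrable_case_nat_fst)
  have "0 \<le> (\<integral>z. g N z \<partial>(M \<Otimes>\<^sub>M S))" for N
  proof -
    let ?f = "\<lambda>N \<omega>. indicator D \<omega> * ?m N \<omega>"
    have intf: "integrable S (?f N)" for N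
      using integrable_real_mult_indicator[OF _ integrable_max_partial_sum[OF int], of D N]
      by (simp add: mult.commute)
    have eq: "(\<lambda>(s, \<omega>). ?f (Suc N) (case_nat s \<omega>)) z = g N z + (\<lambda>(s, \<omega>). ?f N \<omega>) z"
      if "z \<in> space (M \<Otimes>\<^sub>M S)" for z
      using that shift by (auto simp: g_def space_pair_measure indicator_def max_def)
    have 1: "integrable (M \<Otimes>\<^sub>M S) (\<lambda>(s, \<omega>). ?f (Suc N) (case_nat s \<omega>))"
      using intf[of "Suc N"] by (subst (asm) integral_case_nat(1)) (auto simp del: max_partial_sum.simps)
    have "(\<integral>z. g N z \<partial>(M \<Otimes>\<^sub>M S)) =
      (\<integral>z. (\<lambda>(s, \<omega>). ?f (Suc N) (case_nat s \<omega>)) z - (\<lambda>(s, \<omega>). ?f N \<omega>) z \<partial>(M \<Otimes>\<^sub>M S))"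
      by (rule Bochner_Integration.integral_cong) (use eq in \<open>auto\<close>)
    also have "\<dots> = (\<integral>\<omega>. ?f (Suc N) \<omega> \<partial>S) - (\<integral>\<omega>. ?f N \<omega> \<partial>S)"
      using 1 intf[of N] integral_case_nat(2)[of "?f (Suc N)"] integrable_case_nat_snd[OF intf[of N]]
      by (subst Bochner_Integration.integral_diff) (auto simp del: max_partial_sum.simps)
    finally have "(\<integral>z. g N z \<partial>(M \<Otimes>\<^sub>M S)) = (\<integral>\<omega>. ?f (Suc N) \<omega> \<partial>S) - (\<integral>\<omega>. ?f N \<omega> \<partial>S)" .
    moreover have "(\<integral>\<omega>. ?f N \<omega> \<partial>S) \<le> (\<integral>\<omega>. ?f (Suc N) \<omega> \<partial>S)"
      using intf max_partial_sum_mono_Suc by (intro integral_mono mult_left_mono) (auto simp del: max_partial_sum.simps)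
    ultimately show ?thesis by (simp del: max_partial_sum.simps)
  qed
  moreover have "(\<lambda>N. \<integral>z. g N z \<partial>(M \<Otimes>\<^sub>M S)) \<longlonglongrightarrow> (\<integral>z. (\<lambda>(s, \<omega>). Z s * indicator D \<omega>) z \<partial>(M \<Otimes>\<^sub>M S))"
  proof (rule integral_dominated_convergence)
    show "integrable (M \<Otimes>\<^sub>M S) (\<lambda>z. \<bar>(\<lambda>(s, \<omega>). Z s) z\<bar>)"
      using intZ by simp
    show "AE z in M \<Otimes>\<^sub>M S. (\<lambda>N. g N z) \<longlonglongrightarrow> (\<lambda>(s, \<omega>). Z s * indicator D \<omega>) z"
    proof (rule AE_I2, clarify)
      fix s \<omega>
      show "(\<lambda>N. g N (s, \<omega>)) \<longlonglongrightarrow> Z s * indicator D \<omega>"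
      proof (cases "\<omega> \<in> D")
        case True
        then obtain N0 where N0: "- Z s \<le> ?m N0 \<omega>" using unbounded by blast
        have "\<forall>\<^sub>F N in sequentially. g N (s, \<omega>) = Z s * indicator D \<omega>"
          using eventually_ge_at_top[of N0]
        proof eventually_elim
          case (elim N)
          then have "- Z s \<le> ?m N \<omega>"
            using N0 max_partial_sum_mono[of N0 N Z \<omega>] by linarith
          then show ?case
            using True by (simp add: g_def max_def)
        qed
        then show ?thesis by (rule tendsto_eventually)
      qed (simp add: g_def)
    qed
    show "AE z in M \<Otimes>\<^sub>M S. norm (g N z) \<le> \<bar>(\<lambda>(s, \<omega>). Z s) z\<bar>" for N
    proof (rule AE_I2, clarify)
      fix s \<omega>
      show "norm (g N (s, \<omega>)) \<le> \<bar>Z s\<bar>"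
        using max_partial_sum_nonneg[of Z N \<omega>] by (auto simp: g_def indicator_def max_def)
    qed
  qed measurable
  ultimately have "0 \<le> (\<integral>z. (\<lambda>(s, \<omega>). Z s * indicator D \<omega>) z \<partial>(M \<Otimes>\<^sub>M S))"
    by (intro LIMSEQ_le_const) auto
  also have "\<dots> = (\<integral>z. Z z \<partial>M) * measure S D"
  proof -
    have "integrable (M \<Otimes>\<^sub>M S) (\<lambda>(s, \<omega>). Z s * indicator D \<omega>)"
      by (rule Bochner_Integration.integrable_bound[OF intZ])
        (auto intro!: AE_I2 simp: indicator_def)
    from MS.integral_fst'[OF this] show ?thesis
      by (simp add: split_beta')
  qed
  finally have "measure S D = 0"
    using neg by (metis linorder_not_less measure_nonneg mult_neg_pos order_le_less)
  then have "AE \<omega> in S. \<omega> \<notin> D"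
    by (intro AE_not_in) (auto simp: null_sets_def P.emeasure_eq_measure)
  then show ?thesis
  proof (rule AE_mp, intro AE_I2 impI)
    fix \<omega> assume "\<omega> \<in> space S" "\<omega> \<notin> D"
    then obtain k :: nat where "\<And>N. ?m N \<omega> < real k"
      by (auto simp: D_def not_le)
    then show "bdd_above (range (\<lambda>N. \<Sum>i<N. Z (\<omega> i)))"
      by (intro bdd_aboveI[of _ "real k"]) (auto intro: order_trans[OF partial_sum_le_max] less_imp_le)
  qed
qed

text \<open>Subtracting a constant \<open>c'\<close> between the mean and \<open>c\<close> gives
  terms of negative mean; their bounded partial sums vanish after division by \<open>N\<close>.\<close>

lemma AE_eventually_average_less:
  fixes f :: "'a \<Rightarrow> real"
  assumes int: "integrable M f" and c: "(\<integral>z. f z \<partial>M) < c"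
  shows "AE \<omega> in S. \<forall>\<^sub>F N in sequentially. (\<Sum>i<N. f (\<omega> i)) / real N < c"
proof -
  obtain c' where c': "(\<integral>z. f z \<partial>M) < c'" "c' < c" using dense[OF c] by blast
  have "AE \<omega> in S. bdd_above (range (\<lambda>N. \<Sum>i<N. f (\<omega> i) - c'))"
    using int c' by (intro AE_bdd_above_partial_sums) (auto simp: M.prob_space)
  then show ?thesis
  proof eventually_elim
    case (elim \<omega>)
    then obtain K where K: "(\<Sum>i<N. f (\<omega> i) - c') \<le> K" for N
      by (auto simp: bdd_above_def)
    have "(\<lambda>N. K / real N) \<longlonglongrightarrow> 0" by real_asymp
    then have "\<forall>\<^sub>F N in sequentially. K / real N < c - c'"
      using c'(2) by (intro order_tendstoD) auto
    with eventually_gt_at_top[of 0] show ?case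
    proof eventually_elim
      case (elim N)
      then have "(\<Sum>i<N. f (\<omega> i)) \<le> c' * N + K" "K < (c - c') * N"
        using K[of N] by (auto simp: sum_subtractf field_simps)
      then have "(\<Sum>i<N. f (\<omega> i)) < c * N" by (simp add: algebra_simps)
      then show ?case using elim by (simp add: field_simps)
    qed
  qed
qed

theorem strong_law_of_large_numbers:
  fixes f :: "'a \<Rightarrow> real"
  assumes int: "integrable M f"
  shows "AE \<omega> in S. (\<lambda>N. (\<Sum>i<N. f (\<omega> i)) / real N) \<longlonglongrightarrow> (\<integral>z. f z \<partial>M)"
proof -
  let ?e = "\<integral>z. f z \<partial>M"
  have "AE \<omega> in S. \<forall>k::nat. (\<forall>\<^sub>F N in sequentially. (\<Sum>i<N. f (\<omega> i)) / real N < ?e + 1 / Suc k)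
      \<and> (\<forall>\<^sub>F N in sequentially. (\<Sum>i<N. - f (\<omega> i)) / real N < - ?e + 1 / Suc k)"
    unfolding AE_all_countable
  proof
    fix k :: nat
    have "AE \<omega> in S. \<forall>\<^sub>F N in sequentially. (\<Sum>i<N. f (\<omega> i)) / real N < ?e + 1 / Suc k"
      by (rule AE_eventually_average_less[OF int]) simp
    moreover have "AE \<omega> in S. \<forall>\<^sub>F N in sequentially. (\<Sum>i<N. - f (\<omega> i)) / real N < - ?e + 1 / Suc k"
      using int by (intro AE_eventually_average_less) auto
    ultimately show "AE \<omega> in S. (\<forall>\<^sub>F N in sequentially. (\<Sum>i<N. f (\<omega> i)) / real N < ?e + 1 / Suc k)
      \<and> (\<forall>\<^sub>F N in sequentially. (\<Sum>i<N. - f (\<omega> i)) / real N < - ?e + 1 / Suc k)"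
      by (rule AE_conjI)
  qed
  then show ?thesis
  proof eventually_elim
    case (elim \<omega>)
    show ?case
    proof (rule LIMSEQ_I)
      fix r :: real assume "0 < r"
      then obtain k where k: "1 / Suc k < r" using nat_approx_posE by blast
      have "\<forall>\<^sub>F N in sequentially. norm ((\<Sum>i<N. f (\<omega> i)) / real N - ?e) < r"
        using elim[rule_format, of k, THEN conjunct1] elim[rule_format, of k, THEN conjunct2]
        by eventually_elim (use k in \<open>auto simp: sum_negf abs_less_iff\<close>)
      then show "\<exists>no. \<forall>N\<ge>no. norm ((\<Sum>i<N. f (\<omega> i)) / real N - ?e) < r"
        by (simp add: eventually_sequentially)
    qed
  qed
qed

text \<open>The samples that estimate start at index \<open>1\<close>, because index
  \<open>0\<close> is reserved for the point at which the regression function is estimated.\<close>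

corollary strong_law_of_large_numbers_from_1:
  fixes f :: "'a \<Rightarrow> real"
  assumes int: "integrable M f"
  shows "AE \<omega> in S. (\<lambda>N. (\<Sum>i=1..N. f (\<omega> i)) / real N) \<longlonglongrightarrow> (\<integral>z. f z \<partial>M)"
proof -
  have [measurable]: "f \<in> borel_measurable M" using int by auto
  let ?P = "\<lambda>\<omega>. (\<lambda>N. (\<Sum>i<N. f (\<omega> i)) / real N) \<longlonglongrightarrow> (\<integral>z. f z \<partial>M)"
  have "AE z in M \<Otimes>\<^sub>M S. ?P (snd z)"
    using strong_law_of_large_numbers[OF int]
    by (subst (asm) distr_pair_snd[symmetric]) (rule AE_distrD[OF measurable_snd])
  then have "AE z in M \<Otimes>\<^sub>M S. (\<lambda>N. (\<Sum>i=1..N. f ((\<lambda>(s, \<omega>). case_nat s \<omega>) z i)) / real N) \<longlonglongrightarrow> (\<integral>z. f z \<partial>M)"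
    by eventually_elim (simp add: split_beta' sum.atLeast1_atMost_eq)
  then show ?thesis
    by (subst PiM_iter[symmetric], subst AE_distr_iff) (auto simp: split_beta')
qed

end

section \<open>Slowing down a sequence of convergent errors\<close>

text \<open>An inverse of the switching times \<open>m k\<close>: \<open>\<kappa> N\<close> is the
  last index whose switching time has been reached, and \<open>0\<close> before the first one.
  Every index is used, so no grid is skipped.\<close>

lemma slow_index:
  fixes m :: "nat \<Rightarrow> nat"
  assumes m: "strict_mono m"
  obtains \<kappa> where "\<And>k. \<kappa> (m k) = k" "\<And>N. \<kappa> N \<noteq> 0 \<Longrightarrow> m (\<kappa> N) \<le> N" "\<And>k N. m k \<le> N \<Longrightarrow> k \<le> \<kappa> N"
proof -
  define \<kappa> where "\<kappa> N = Max {k. k \<le> N \<and> (k = 0 \<or> m k \<le> N)}" for N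
  have fin: "finite {k. k \<le> N \<and> (k = 0 \<or> m k \<le> N)}" for N
    by (rule finite_subset[of _ "{..N}"]) auto
  have self: "k \<le> m k" for k
    using strict_mono_imp_increasing[OF m] .
  have mem: "\<kappa> N \<in> {k. k \<le> N \<and> (k = 0 \<or> m k \<le> N)}" for N
    unfolding \<kappa>_def by (rule Max_in[OF fin]) auto
  have le: "m (\<kappa> N) \<le> N" if "\<kappa> N \<noteq> 0" for N
    using mem[of N] that by simp
  have ge: "k \<le> \<kappa> N" if "m k \<le> N" for k N
    unfolding \<kappa>_def using that self[of k] by (intro Max_ge[OF fin]) auto
  have "\<kappa> (m k) = k" for k
  proof (rule antisym)
    show "\<kappa> (m k) \<le> k"
    proof (cases "\<kappa> (m k) = 0")
      case False
      then show ?thesis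
        using le strict_mono_less_eq[OF m] by blast
    qed simp
  qed (rule ge, simp)
  with le ge show thesis by (intro that)
qed

text \<open>Almost sure convergence of the \<open>k\<close>-th error makes the event that it ever
  exceeds \<open>2^-k\<close> from time \<open>n k\<close> on have probability below
  \<open>2^-k\<close>, for a suitable \<open>n k\<close>. If error \<open>k\<close> is consulted
  only from time \<open>n k\<close> on, the Borel-Cantelli lemma applies.\<close>

lemma (in prob_space) slow_diagonal:
  fixes E :: "nat \<Rightarrow> nat \<Rightarrow> 'a \<Rightarrow> real"
  assumes [measurable]: "\<And>k N. E k N \<in> borel_measurable M"
    and lim: "\<And>k. AE \<omega> in M. (\<lambda>N. E k N \<omega>) \<longlonglongrightarrow> 0"
  obtains \<kappa> where "filterlim \<kappa> at_top sequentially" "surj \<kappa>"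
    "AE \<omega> in M. (\<lambda>N. E (\<kappa> N) N \<omega>) \<longlonglongrightarrow> 0"
proof -
  define late where "late k n = {\<omega> \<in> space M. \<exists>N\<ge>n. (1/2) ^ k < \<bar>E k N \<omega>\<bar>}" for k n
  have [measurable]: "late k n \<in> events" for k n
    unfolding late_def by measurable
  have "\<exists>n. prob (late k n) < (1/2) ^ k" for k
  proof -
    have "AE \<omega> in M. \<omega> \<notin> (\<Inter>n. late k n)"
      using lim[of k]
    proof eventually_elim
      case (elim \<omega>)
      then obtain n where "\<forall>N\<ge>n. \<bar>E k N \<omega>\<bar> < (1/2) ^ k"
        using LIMSEQ_D[of "\<lambda>N. E k N \<omega>" 0 "(1/2) ^ k"] by auto
      then have "\<omega> \<notin> late k n"
        by (force simp: late_def)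
      then show ?case by blast
    qed
    then have "prob (\<Inter>n. late k n) = 0"
      using prob_eq_0[of "\<Inter>n. late k n"] by auto
    moreover have "(\<lambda>n. prob (late k n)) \<longlonglongrightarrow> prob (\<Inter>n. late k n)"
      by (rule finite_Lim_measure_decseq) (auto simp: decseq_def late_def intro: order_trans)
    ultimately have "\<forall>\<^sub>F n in sequentially. prob (late k n) < (1/2) ^ k"
      by (intro order_tendstoD(2)[of _ 0]) auto
    then show ?thesis
      by (rule eventually_happens'[rotated]) simp
  qed
  then obtain n where n: "\<And>k. prob (late k (n k)) < (1/2) ^ k"
    by metis
  define m where "m k = k + (\<Sum>i\<le>k. n i)" for k
  have m: "strict_mono m"
    unfolding strict_mono_Suc_iff by (simp add: m_def)
  have m_ge: "n k \<le> m k" for k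
    unfolding m_def by (simp add: trans_le_add2 member_le_sum)
  obtain \<kappa> where \<kappa>: "\<And>k. \<kappa> (m k) = k" "\<And>N. \<kappa> N \<noteq> 0 \<Longrightarrow> m (\<kappa> N) \<le> N"
    "\<And>k N. m k \<le> N \<Longrightarrow> k \<le> \<kappa> N"
    using slow_index[OF m] by blast
  show thesis
  proof (rule that[of \<kappa>])
    show "filterlim \<kappa> at_top sequentially"
      unfolding filterlim_at_top eventually_sequentially
    proof (intro allI exI impI)
      show "k \<le> \<kappa> N" if "m k \<le> N" for k N
        using that by (rule \<kappa>(3))
    qed
    show "surj \<kappa>"
      using \<kappa>(1) by (rule surjI)
    have "AE \<omega> in M. \<forall>\<^sub>F k in sequentially. \<omega> \<in> space M - late k (n k)"
    proof (rule borel_cantelli_AE1)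
      show "summable (\<lambda>k. prob (late k (n k)))"
        by (rule summable_comparison_test'[of "\<lambda>k. (1/2) ^ k :: real" 0]) (auto intro: less_imp_le n)
    qed (auto simp: emeasure_eq_measure)
    then show "AE \<omega> in M. (\<lambda>N. E (\<kappa> N) N \<omega>) \<longlonglongrightarrow> 0"
    proof eventually_elim
      case (elim \<omega>)
      then obtain K where K: "\<And>k. K \<le> k \<Longrightarrow> \<omega> \<in> space M - late k (n k)"
        by (auto simp: eventually_sequentially)
      show ?case
      proof (rule LIMSEQ_I)
        fix e :: real assume "0 < e"
        obtain k0 where k0: "(1/2) ^ k0 < e"
          using real_arch_pow_inv[OF \<open>0 < e\<close>, of "1/2"] by auto
        define k where "k = Max {K, k0, 1}"
        have k: "K \<le> k" "k0 \<le> k" "1 \<le> k" by (auto simp: k_def)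
        have "norm (E (\<kappa> N) N \<omega> - 0) < e" if "m k \<le> N" for N
        proof -
          have \<kappa>k: "k \<le> \<kappa> N" using \<kappa>(3)[OF that] .
          then have "n (\<kappa> N) \<le> N"
            using \<kappa>(2)[of N] m_ge[of "\<kappa> N"] k by linarith
          then have "\<bar>E (\<kappa> N) N \<omega>\<bar> \<le> (1/2) ^ \<kappa> N"
            using K[of "\<kappa> N"] k \<kappa>k by (auto simp: late_def not_less)
          also have "\<dots> \<le> (1/2) ^ k0"
            using \<kappa>k k by (intro power_decreasing) auto
          finally show ?thesis using k0 by simp
        qed
        then show "\<exists>no. \<forall>N\<ge>no. norm (E (\<kappa> N) N \<omega> - 0) < e" by blast
      qed
    qed
  qed
qed

section \<open>A sample without noise\<close>

lemma fst_borel_measurable [measurable]: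
  "(fst :: 'a::topological_space \<times> 'b::topological_space \<Rightarrow> 'a) \<in> borel \<rightarrow>\<^sub>M borel"
  and snd_borel_measurable [measurable]:
  "(snd :: 'a \<times> 'b \<Rightarrow> 'b) \<in> borel \<rightarrow>\<^sub>M borel"
  by (auto intro!: borel_measurable_continuous_onI continuous_intros)

text \<open>The joint law of point and response lives on the graph of \<open>h\<close>, so all
  expectations reduce to integrals over the square.\<close>

locale noiseless_sample =
  fixes h :: "real \<times> real \<Rightarrow> real"
  assumes h_measurable [measurable]: "h \<in> borel_measurable borel"
    and h_integrable: "integrable uniform_square h"
begin

definition law :: "((real \<times> real) \<times> real) measure" where
  "law = distr uniform_square borel (\<lambda>x. (x, h x))"

lemma graph_measurable [measurable]: "(\<lambda>x. (x, h x)) \<in> uniform_square \<rightarrow>\<^sub>M borel"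
  by measurable

lemma sets_law [measurable_cong, simp]: "sets law = sets borel"
  by (simp add: law_def)

lemma space_law [simp]: "space law = UNIV"
  by (simp add: law_def)

lemma prob_space_law: "prob_space law"
  unfolding law_def by (intro uniform_square.prob_space_distr) simp

sublocale sample: sequence_space law
  by (intro sequence_space.intro product_prob_spaceI prob_space_law)

abbreviation \<Omega> :: "(nat \<Rightarrow> (real \<times> real) \<times> real) measure" where
  "\<Omega> \<equiv> \<Pi>\<^sub>M i\<in>UNIV. law"

lemma component_measurable [measurable]: "(\<lambda>\<omega>. \<omega> i) \<in> \<Omega> \<rightarrow>\<^sub>M borel"
proof -
  have "(\<lambda>\<omega>. \<omega> i) \<in> \<Omega> \<rightarrow>\<^sub>M law" by measurable
  then show ?thesis by (simp cong: measurable_cong_sets)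
qed

lemma fst_component_measurable [measurable]: "(\<lambda>\<omega>. fst (\<omega> i)) \<in> \<Omega> \<rightarrow>\<^sub>M borel"
  and snd_component_measurable [measurable]: "(\<lambda>\<omega>. snd (\<omega> i)) \<in> \<Omega> \<rightarrow>\<^sub>M borel"
  by measurable

lemma distr_component: "distr \<Omega> borel (\<lambda>\<omega>. \<omega> i) = law"
proof -
  have "distr \<Omega> borel (\<lambda>\<omega>. \<omega> i) = distr \<Omega> law (\<lambda>\<omega>. \<omega> i)"
    by (rule distr_cong) auto
  then show ?thesis
    using sample.PiM_component[of i] by simp
qed

lemma distr_fst_law: "distr law borel fst = uniform_square"
proof -
  have "distr law borel fst = distr uniform_square borel (\<lambda>x. x)"
    unfolding law_def by (subst distr_distr) (auto simp: comp_def)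
  also have "\<dots> = uniform_square"
    by (rule distr_id2) simp
  finally show ?thesis .
qed

lemma distr_design: "distr \<Omega> borel (\<lambda>\<omega>. fst (\<omega> i)) = uniform_square"
proof -
  have "distr \<Omega> borel (\<lambda>\<omega>. fst (\<omega> i)) = distr (distr \<Omega> borel (\<lambda>\<omega>. \<omega> i)) borel fst"
    by (subst distr_distr) (auto simp: comp_def)
  then show ?thesis
    by (simp add: distr_component distr_fst_law)
qed

lemma AE_design: "AE x in uniform_square. P x \<Longrightarrow> AE \<omega> in \<Omega>. P (fst (\<omega> i))"
  using AE_distrD[OF fst_component_measurable, of P i] unfolding distr_design .

lemma AE_response: "AE \<omega> in \<Omega>. snd (\<omega> i) = h (fst (\<omega> i))"
proof -
  have "AE z in law. snd z = h (fst z)"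
    unfolding law_def by (subst AE_distr_iff) auto
  then have "AE z in distr \<Omega> borel (\<lambda>\<omega>. \<omega> i). snd z = h (fst z)"
    unfolding distr_component .
  then show ?thesis
    by (rule AE_distrD[OF component_measurable])
qed

lemma indep_components: "sample.P.indep_vars (\<lambda>_. borel) (\<lambda>i \<omega>. \<omega> i) UNIV"
proof -
  have "distr \<Omega> (\<Pi>\<^sub>M i\<in>UNIV. borel) (\<lambda>\<omega>. \<omega>) = \<Omega>"
    by (rule distr_id2) (rule sets_PiM_cong, auto)
  then show ?thesis
    by (subst sample.P.indep_vars_iff_distr_eq_PiM) (auto simp: distr_component restrict_def)
qed

lemma integrable_response: "integrable \<Omega> (\<lambda>\<omega>. snd (\<omega> i))"
proof -
  have "integrable \<Omega> (\<lambda>\<omega>. h (fst (\<omega> i)))"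
    using h_integrable unfolding distr_design[of i, symmetric] by (subst (asm) integrable_distr_eq) auto
  then show ?thesis
    using AE_response[of i] by (subst integrable_cong_AE) auto
qed

text \<open>Almost surely the response is a function of the point, so it is its own conditional
  expectation.\<close>

lemma regression_function_design: "regression_function \<Omega> (\<lambda>\<omega>. fst (\<omega> i)) (\<lambda>\<omega>. snd (\<omega> i)) h"
proof -
  let ?F = "vimage_algebra (space \<Omega>) (\<lambda>\<omega>. fst (\<omega> i)) (borel :: (real \<times> real) measure)"
  have "subalgebra \<Omega> ?F"
    by (simp add: subalgebra_def sets_vimage_algebra2 measurable_sets subset_eq) 
       (auto simp: sets_vimage_algebra2 intro!: measurable_sets)
  then interpret finite_measure_subalgebra \<Omega> ?F
    by (intro finite_measure_subalgebra.intro finite_measure_subalgebra_axioms.intro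
        sample.P.finite_measure_axioms)
  have F: "(\<lambda>\<omega>. h (fst (\<omega> i))) \<in> borel_measurable ?F"
    by (rule measurable_compose[OF measurable_vimage_algebra1 h_measurable]) auto
  have "integrable \<Omega> (\<lambda>\<omega>. h (fst (\<omega> i)))"
    using h_integrable unfolding distr_design[of i, symmetric] by (subst (asm) integrable_distr_eq) auto
  then have "AE \<omega> in \<Omega>. real_cond_exp \<Omega> ?F (\<lambda>\<omega>. h (fst (\<omega> i))) \<omega> = h (fst (\<omega> i))"
    using F by (rule real_cond_exp_F_meas)
  moreover have "AE \<omega> in \<Omega>. real_cond_exp \<Omega> ?F (\<lambda>\<omega>. snd (\<omega> i)) \<omega> = real_cond_exp \<Omega> ?F (\<lambda>\<omega>. h (fst (\<omega> i))) \<omega>"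
    by (rule real_cond_exp_cong[OF AE_response]) auto
  ultimately show ?thesis
    unfolding regression_function_def by (auto elim: eventually_elim2)
qed

lemma integral_component:
  fixes u :: "(real \<times> real) \<times> real \<Rightarrow> real"
  assumes [measurable]: "u \<in> borel_measurable borel"
  shows "integrable \<Omega> (\<lambda>\<omega>. u (\<omega> i)) \<longleftrightarrow> integrable uniform_square (\<lambda>x. u (x, h x))"
    "(\<integral>\<omega>. u (\<omega> i) \<partial>\<Omega>) = (\<integral>x. u (x, h x) \<partial>uniform_square)"
    "integrable law u \<longleftrightarrow> integrable uniform_square (\<lambda>x. u (x, h x))"
    "(\<integral>z. u z \<partial>law) = (\<integral>x. u (x, h x) \<partial>uniform_square)"
proof -
  show 1: "integrable law u \<longleftrightarrow> integrable uniform_square (\<lambda>x. u (x, h x))"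
    unfolding law_def by (rule integrable_distr_eq) auto
  show 2: "(\<integral>z. u z \<partial>law) = (\<integral>x. u (x, h x) \<partial>uniform_square)"
    unfolding law_def by (rule integral_distr) auto
  have "integrable (distr \<Omega> borel (\<lambda>\<omega>. \<omega> i)) u \<longleftrightarrow> integrable \<Omega> (\<lambda>\<omega>. u (\<omega> i))"
    "(\<integral>z. u z \<partial>distr \<Omega> borel (\<lambda>\<omega>. \<omega> i)) = (\<integral>\<omega>. u (\<omega> i) \<partial>\<Omega>)"
    by (rule integrable_distr_eq integral_distr; simp)+
  with 1 2 show "integrable \<Omega> (\<lambda>\<omega>. u (\<omega> i)) \<longleftrightarrow> integrable uniform_square (\<lambda>x. u (x, h x))"
    "(\<integral>\<omega>. u (\<omega> i) \<partial>\<Omega>) = (\<integral>x. u (x, h x) \<partial>uniform_square)"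
    unfolding distr_component by simp_all
qed

lemma cell_mean_eq_box_mean:
  assumes [measurable]: "cell Q x \<in> sets borel"
  shows "cell_mean \<Omega> (\<lambda>\<omega>. fst (\<omega> i)) (\<lambda>\<omega>. snd (\<omega> i)) Q x = box_mean h (cell Q x)"
proof -
  have [measurable]: "(\<lambda>z::(real \<times> real) \<times> real. snd z * indicator (cell Q x) (fst z) :: real) \<in> borel_measurable borel"
    by measurable
  have "measure \<Omega> {\<omega> \<in> space \<Omega>. fst (\<omega> i) \<in> cell Q x} = measure (distr \<Omega> borel (\<lambda>\<omega>. fst (\<omega> i))) (cell Q x)"
    by (subst measure_distr) (auto intro!: arg_cong[of _ _ "measure \<Omega>"])
  then show ?thesis
    using integral_component(2)[of "\<lambda>z. snd z * indicator (cell Q x) (fst z)" i]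
    by (simp add: cell_mean_def box_mean_def distr_design)
qed

definition sample_mean :: "nat \<Rightarrow> (real \<times> real) set \<Rightarrow> (nat \<Rightarrow> (real \<times> real) \<times> real) \<Rightarrow> real" where
  "sample_mean N B \<omega> =
     (if empirical_F N (\<lambda>n. fst (\<omega> n)) B > 0
      then empirical_mu N (\<lambda>n. fst (\<omega> n)) (\<lambda>n. snd (\<omega> n)) B / empirical_F N (\<lambda>n. fst (\<omega> n)) B else 0)"

lemma sample_mean_measurable [measurable]:
  assumes [measurable]: "B \<in> sets borel"
  shows "sample_mean N B \<in> borel_measurable \<Omega>"
  unfolding sample_mean_def[abs_def] empirical_F_def empirical_mu_def by measurable

text \<open>The law of large numbers for numerator and denominator; the denominator has a positive
  limit, so the default value for empty cells is eventually irrelevant.\<close>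

lemma sample_mean_consistent:
  assumes [measurable]: "B \<in> sets borel" and pos: "0 < measure uniform_square B"
  shows "AE \<omega> in \<Omega>. (\<lambda>N. sample_mean N B \<omega>) \<longlonglongrightarrow> box_mean h B"
proof -
  have [measurable]: "(\<lambda>z::(real \<times> real) \<times> real. snd z * indicator B (fst z) :: real) \<in> borel_measurable borel"
    "(\<lambda>z::(real \<times> real) \<times> real. indicator B (fst z) :: real) \<in> borel_measurable borel"
    by measurable
  have hB: "integrable uniform_square (\<lambda>x. h x * indicator B x)"
    using h_integrable by (intro integrable_real_mult_indicator) auto
  have iB: "integrable uniform_square (indicator B :: _ \<Rightarrow> real)"
    by (rule integrable_real_indicator) (auto simp: uniform_square.emeasure_eq_measure)
  have "AE \<omega> in \<Omega>. (\<lambda>N. (\<Sum>n=1..N. snd (\<omega> n) * indicator B (fst (\<omega> n))) / real N)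
      \<longlonglongrightarrow> (\<integral>x. h x * indicator B x \<partial>uniform_square)"
    using sample.strong_law_of_large_numbers_from_1[of "\<lambda>z. snd z * indicator B (fst z)"] hB
    by (simp add: integral_component)
  moreover have "AE \<omega> in \<Omega>. (\<lambda>N. (\<Sum>n=1..N. indicator B (fst (\<omega> n))) / real N)
      \<longlonglongrightarrow> measure uniform_square B"
    using sample.strong_law_of_large_numbers_from_1[of "\<lambda>z. indicator B (fst z)"] iB
    by (simp add: integral_component)
  ultimately show ?thesis
  proof eventually_elim
    case (elim \<omega>)
    let ?F = "\<lambda>N. empirical_F N (\<lambda>n. fst (\<omega> n)) B"
    let ?\<mu> = "\<lambda>N. empirical_mu N (\<lambda>n. fst (\<omega> n)) (\<lambda>n. snd (\<omega> n)) B"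
    have F: "?F \<longlonglongrightarrow> measure uniform_square B"
      using elim(2) by (simp add: empirical_F_def)
    have \<mu>: "?\<mu> \<longlonglongrightarrow> (\<integral>x. h x * indicator B x \<partial>uniform_square)"
      using elim(1) by (simp add: empirical_mu_def)
    have "(\<lambda>N. ?\<mu> N / ?F N) \<longlonglongrightarrow> box_mean h B"
      unfolding box_mean_def using \<mu> F pos by (intro tendsto_divide) auto
    moreover have "\<forall>\<^sub>F N in sequentially. sample_mean N B \<omega> = ?\<mu> N / ?F N"
      using order_tendstoD(1)[OF F pos] by eventually_elim (simp add: sample_mean_def)
    ultimately show ?case
      by (simp add: tendsto_cong)
  qed
qed

text \<open>The sum over all cells bounds the error at every point of the square at once, so it
  does not matter that the cell is chosen by the random point \<open>\<omega> 0\<close>.\<close>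

definition grid_error :: "nat \<Rightarrow> nat \<Rightarrow> nat \<Rightarrow> (nat \<Rightarrow> (real \<times> real) \<times> real) \<Rightarrow> real" where
  "grid_error p q N \<omega> = (\<Sum>B\<in>grid p q. \<bar>sample_mean N B \<omega> - box_mean h B\<bar>)"

lemma grid_sets: "B \<in> grid p q \<Longrightarrow> B \<in> sets borel"
  by (auto simp: grid_def)

lemma grid_error_measurable [measurable]: "grid_error p q N \<in> borel_measurable \<Omega>"
  unfolding grid_error_def[abs_def]
  by (intro borel_measurable_sum borel_measurable_abs borel_measurable_diff sample_mean_measurable)
    (auto dest: grid_sets)

lemma grid_error_tendsto_0: "AE \<omega> in \<Omega>. (\<lambda>N. grid_error p q N \<omega>) \<longlonglongrightarrow> 0"
proof -
  have "AE \<omega> in \<Omega>. \<forall>B\<in>grid p q. (\<lambda>N. sample_mean N B \<omega>) \<longlonglongrightarrow> box_mean h B"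
  proof (rule AE_ball_countable[THEN iffD2])
    show "countable (grid p q)" by (simp add: countable_finite)
    show "\<forall>B\<in>grid p q. AE \<omega> in \<Omega>. (\<lambda>N. sample_mean N B \<omega>) \<longlonglongrightarrow> box_mean h B"
    proof
      fix B assume B: "B \<in> grid p q"
      then obtain i l where "i < 2 ^ p" "l < 2 ^ q" "B = grid_box p q (i, l)"
        using grid_subset[of p q] by auto
      then have "0 < measure uniform_square B"
        using emeasure_grid_box[of i p l q] by (simp add: uniform_square.emeasure_eq_measure)
      then show "AE \<omega> in \<Omega>. (\<lambda>N. sample_mean N B \<omega>) \<longlonglongrightarrow> box_mean h B"
        using grid_sets[OF B] by (intro sample_mean_consistent)
    qed
  qed
  then show ?thesis
  proof eventually_elim
    case (elim \<omega>)
    show ?case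
      unfolding grid_error_def
      using elim by (intro tendsto_null_sum tendsto_rabs_zero LIM_zero) auto
  qed
qed

lemma error_le_grid_error:
  assumes "x \<in> unit_square"
  shows "\<bar>empirical_cell_mean N (\<lambda>n. fst (\<omega> n)) (\<lambda>n. snd (\<omega> n)) (grid p q) x - box_mean h (cell (grid p q) x)\<bar>
    \<le> grid_error p q N \<omega>"
proof -
  have "cell (grid p q) x \<in> grid p q"
    unfolding cell_grid[OF assms] using assms by (simp add: grid_def)
  then have "\<bar>sample_mean N (cell (grid p q) x) \<omega> - box_mean h (cell (grid p q) x)\<bar> \<le> grid_error p q N \<omega>"
    unfolding grid_error_def by (intro member_le_sum) auto
  then show ?thesis
    by (simp add: empirical_cell_mean_def sample_mean_def)
qed

end

section \<open>Consistent estimation of inconsistent means\<close>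

theorem theorem1p2:
  "\<exists>(Q :: nat \<Rightarrow> (real \<times> real) set set)
    (M :: (nat \<Rightarrow> (real \<times> real) \<times> real) measure) X Y Xs Ys h.
     (\<forall>N\<ge>1. tree_structured_partition (Q N)) \<and>
     (\<lambda>N. partition_norm (Q N)) \<longlonglongrightarrow> 0 \<and>
     prob_space M \<and>
     prob_space.indep_vars M (\<lambda>_. borel)
       (\<lambda>n \<omega>. if n = 0 then (X \<omega>, Y \<omega>) else (Xs n \<omega>, Ys n \<omega>)) (UNIV :: nat set) \<and>
     (\<forall>n\<ge>1. distr M borel (\<lambda>\<omega>. (Xs n \<omega>, Ys n \<omega>)) = distr M borel (\<lambda>\<omega>. (X \<omega>, Y \<omega>))) \<and>
     distr M borel X = uniform_measure lborel unit_square \<and>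
     integrable M Y \<and>
     regression_function M X Y h \<and>
     (AE \<omega> in M. (\<lambda>N. empirical_cell_mean N (\<lambda>n. Xs n \<omega>) (\<lambda>n. Ys n \<omega>) (Q N) (X \<omega>)
                       - cell_mean M X Y (Q N) (X \<omega>)) \<longlonglongrightarrow> 0) \<and>
     (AE \<omega> in M. \<not> (\<lambda>N. cell_mean M X Y (Q N) (X \<omega>) - h (X \<omega>)) \<longlonglongrightarrow> 0) \<and>
     (AE \<omega> in M. \<not> (\<lambda>N. empirical_cell_mean N (\<lambda>n. Xs n \<omega>) (\<lambda>n. Ys n \<omega>) (Q N) (X \<omega>))
                       \<longlonglongrightarrow> h (X \<omega>))"
proof -
  obtain h :: "real \<times> real \<Rightarrow> real" and g :: "nat \<Rightarrow> nat \<times> nat"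
    where h: "h \<in> borel_measurable borel" "integrable uniform_square h"
      and fine: "filterlim (\<lambda>k. fst (g k)) at_top sequentially" "filterlim (\<lambda>k. snd (g k)) at_top sequentially"
      and divergent: "AE x in uniform_square. \<forall>K. \<exists>k. K \<le> box_mean h (cell (grid (fst (g k)) (snd (g k))) x)"
    by (rule divergent_box_means)
  interpret noiseless_sample h
    using h by unfold_locales
  obtain \<kappa> where \<kappa>: "filterlim \<kappa> at_top sequentially" "surj \<kappa>"
    and error: "AE \<omega> in \<Omega>. (\<lambda>N. grid_error (fst (g (\<kappa> N))) (snd (g (\<kappa> N))) N \<omega>) \<longlonglongrightarrow> 0"
    by (rule sample.P.slow_diagonal[of "\<lambda>k. grid_error (fst (g k)) (snd (g k))",
          OF grid_error_measurable grid_error_tendsto_0])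
  define Q where "Q N = grid (fst (g (\<kappa> N))) (snd (g (\<kappa> N)))" for N
  let ?X = "\<lambda>\<omega> :: nat \<Rightarrow> (real \<times> real) \<times> real. fst (\<omega> 0)"
  let ?Y = "\<lambda>\<omega> :: nat \<Rightarrow> (real \<times> real) \<times> real. snd (\<omega> 0)"
  let ?Xs = "\<lambda>n \<omega> :: nat \<Rightarrow> (real \<times> real) \<times> real. fst (\<omega> n)"
  let ?Ys = "\<lambda>n \<omega> :: nat \<Rightarrow> (real \<times> real) \<times> real. snd (\<omega> n)"
  let ?emp = "\<lambda>\<omega> N. empirical_cell_mean N (\<lambda>n. ?Xs n \<omega>) (\<lambda>n. ?Ys n \<omega>) (Q N) (?X \<omega>)"
  let ?mean = "\<lambda>\<omega> N. cell_mean \<Omega> ?X ?Y (Q N) (?X \<omega>)"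
  have mean: "?mean \<omega> N = box_mean h (cell (Q N) (?X \<omega>))" if "?X \<omega> \<in> unit_square" for \<omega> N
    using that by (intro cell_mean_eq_box_mean) (simp add: Q_def cell_grid)
  have in_square: "AE \<omega> in \<Omega>. ?X \<omega> \<in> unit_square"
    using AE_uniform_square by (rule AE_design)
  have consistent: "AE \<omega> in \<Omega>. (\<lambda>N. ?emp \<omega> N - ?mean \<omega> N) \<longlonglongrightarrow> 0"
    using error in_square
  proof eventually_elim
    case (elim \<omega>)
    show ?case
      using error_le_grid_error[OF elim(2)] mean[of \<omega>, OF elim(2)]
      by (intro Lim_null_comparison[OF _ elim(1)] always_eventually) (simp add: Q_def)
  qed
  \<comment> \<open>Surjectivity of \<open>\<kappa>\<close> matters here: the large means occur
    for particular grids, each of which must be used.\<close>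
  have unbounded: "AE \<omega> in \<Omega>. \<not> Bseq (?mean \<omega>)"
    using AE_design[OF divergent, of 0] in_square
  proof eventually_elim
    case (elim \<omega>)
    show ?case
    proof
      assume "Bseq (?mean \<omega>)"
      then obtain K where K: "\<And>N. \<bar>?mean \<omega> N\<bar> \<le> K"
        by (auto simp: Bseq_def)
      obtain k where k: "K + 1 \<le> box_mean h (cell (grid (fst (g k)) (snd (g k))) (?X \<omega>))"
        using elim(1) by blast
      obtain N where N: "k = \<kappa> N"
        using surjD[OF \<kappa>(2)] by blast
      have "K + 1 \<le> ?mean \<omega> N"
        using k mean[of \<omega> N, OF elim(2)] by (simp add: N Q_def)
      with K[of N] show False by linarith
    qed
  qed
  have inconsistent: "AE \<omega> in \<Omega>. \<not> (\<lambda>N. ?mean \<omega> N - h (?X \<omega>)) \<longlonglongrightarrow> 0"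
    using unbounded
  proof eventually_elim
    case (elim \<omega>)
    then show ?case
      using LIM_zero_cancel[of "?mean \<omega>"] convergent_imp_Bseq[of "?mean \<omega>"] by (auto simp: convergent_def)
  qed
  have inconsistent_estimate: "AE \<omega> in \<Omega>. \<not> (?emp \<omega>) \<longlonglongrightarrow> h (?X \<omega>)"
    using inconsistent consistent
  proof eventually_elim
    case (elim \<omega>)
    show ?case
    proof
      assume "(?emp \<omega>) \<longlonglongrightarrow> h (?X \<omega>)"
      then have "(\<lambda>N. (?emp \<omega> N - h (?X \<omega>)) - (?emp \<omega> N - ?mean \<omega> N)) \<longlonglongrightarrow> 0 - 0"
        by (intro tendsto_diff LIM_zero elim)
      with elim(1) show False by simp
    qed
  qed
  have norm: "(\<lambda>N. partition_norm (Q N)) \<longlonglongrightarrow> 0"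
    unfolding Q_def by (intro partition_norm_grid_tendsto_0 filterlim_compose[OF fine(1) \<kappa>(1)] filterlim_compose[OF fine(2) \<kappa>(1)])
  have indep: "sample.P.indep_vars (\<lambda>_. borel)
      (\<lambda>n \<omega>. if n = 0 then (?X \<omega>, ?Y \<omega>) else (?Xs n \<omega>, ?Ys n \<omega>)) UNIV"
  proof -
    have "(\<lambda>n \<omega>. if n = 0 then (?X \<omega>, ?Y \<omega>) else (?Xs n \<omega>, ?Ys n \<omega>)) = (\<lambda>n \<omega>. \<omega> n)"
      by (auto simp: fun_eq_iff)
    then show ?thesis
      using indep_components by simp
  qed
  show ?thesis
  proof (rule exI[of _ Q], rule exI[of _ \<Omega>], rule exI[of _ ?X], rule exI[of _ ?Y],
      rule exI[of _ ?Xs], rule exI[of _ ?Ys], rule exI[of _ h], intro conjI allI impI)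
    show "tree_structured_partition (Q N)" for N
      unfolding Q_def by (rule tree_structured_partition_grid)
    show "distr \<Omega> borel (\<lambda>\<omega>. (?Xs n \<omega>, ?Ys n \<omega>)) = distr \<Omega> borel (\<lambda>\<omega>. (?X \<omega>, ?Y \<omega>))" for n
      by (simp add: distr_component)
  qed (fact norm sample.P.prob_space_axioms indep distr_design integrable_response
      regression_function_design consistent inconsistent inconsistent_estimate)+
qed

end
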